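(* Let $\alpha_1,\dots,\alpha_8\in RW(4,4)$ be the elements defined in the context. For all $i,j=1,\dots,8$, $$[{\alpha_i}_\lambda\alpha_j]=(\lambda_i\lambda_jB_{\lambda\lambda}-2\lambda_i\mu_j-2\lambda_j\mu_i)C_{\lambda\alpha}+3\lambda_i\lambda_jB_{\mu\alpha}+(\lambda_iC_{\mu\partial}+\lambda_iB_{\lambda\lambda}C_{\lambda\partial}-2\mu_iC_{\lambda\partial})\alpha_j .$$ In particular, the $\mathbb F[\partial]$-submodule $RE(4,4)$ of $RW(4,4)$ generated by $\alpha_1,\dots,\alpha_8$ is a Lie conformal subalgebra of $RW(4,4)$.
   Context: Base field $\mathbb F$ of characteristic $0$; $p(\cdot)$ denotes parity. Sets of $8$ variables $\lambda_i,\partial_i$ ($1\le i\le8$) have parity $p_i=\bar0$ for $i\le4$ and $p_i=\bar1$ for $i\ge5$; all variables supercommute, in particular $\lambda_i\lambda_j=(-1)^{p_ip_j}\lambda_j\lambda_i$, and similarly for the $\partial_i$ and between the $\lambda_i$ and the $\partial_j$. $\mathbb F[\lambda]$, $\mathbb F[\partial]$ denote the free supercommutative algebras. In $\mathbb F[\lambda]\otimes R$ one has $a\lambda_i=(-1)^{p_ip(a)}\lambda_ia$. Lie conformal superalgebra of type $(r,s)$ (here $r=s=4$): a $\mathbb Z/2\mathbb Z$-graded $\mathbb F[\partial]$-bimodule $R$ with $a\partial_i=(-1)^{p_ip(a)}\partial_i a$ and a graded linear map $R\otimes R\to\mathbb F[\lambda]\otimes R$, $a\otimes b\mapsto[a_\lambda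 b]$ such that $[(\partial_i a)_\lambda b]=-\lambda_i[a_\lambda b]$, $[a_\lambda(b\partial_i)]=[a_\lambda b](\partial_i+\lambda_i)$ (sesquilinearity); $[b_\lambda a]=-(-1)^{p(a)p(b)}[a_{-\lambda-\partial}b]$; and, with a second set of variables $\lambda'_i$ of the same parities, $[a_\lambda[b_{\lambda'}c]]=[[a_\lambda b]_{\lambda+\lambda'}c]+(-1)^{p(a)p(b)}[b_{\lambda'}[a_\lambda c]]$. $RW(4,4)$ is the Lie conformal superalgebra of type $(4,4)$ which is the free $\mathbb F[\partial]$-module with even generators $a_1,\dots,a_4$ and odd generators $a_5,\dots,a_8$, with $\lambda$-bracket $[{a_i}_\lambda a_j]=(\partial_i+\lambda_i)a_j+a_i\lambda_j$ extended by sesquilinearity. A Lie conformal subalgebra is an $\mathbb F[\partial]$-submodule $S$ with $[S_\lambda S]\subset\mathbb F[\lambda]\otimes S$. For $u=(u_1,\dots,u_8)$, $v=(v_1,\dots,v_8)$ put $B_{uv}=\sum_{i=1}^4u_iv_{i+4}$ and $C_{uv}=\sum_{i=1}^4(u_iv_{i+4}+u_{i+4}v_i)$. Let $\nu_1=\partial_6\partial_7\partial_8$, $\nu_2=-\partial_5\partial_7\partial_8$, $\nu_3=\partial_5\partial_6\partial_8$, $\nu_4=-\partial_5\partial_6\partial_7$, $\nu_5=\dots=\nu_8=0$, and $$\alpha_i=\partial_iB_{\partial\partial}C_{\partial a}-2\nu_iC_{\partial a}+\partial_iB_{\nu a},\qquad i=1,\dots,8.$$ Let $\mu_1=\lambda_6\lambda_7\lambda_8$,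 $\mu_2=-\lambda_5\lambda_7\lambda_8$, $\mu_3=\lambda_5\lambda_6\lambda_8$, $\mu_4=-\lambda_5\lambda_6\lambda_7$, $\mu_5=\dots=\mu_8=0$. Thus $B_{\lambda\lambda}=\sum_{i=1}^4\lambda_i\lambda_{i+4}$, $C_{\lambda\partial}=\sum_{i=1}^4(\lambda_i\partial_{i+4}+\lambda_{i+4}\partial_i)$, $C_{\mu\partial}=\sum_{i=1}^4\mu_i\partial_{i+4}$, $C_{\lambda\alpha}=\sum_{i=1}^4(\lambda_i\alpha_{i+4}+\lambda_{i+4}\alpha_i)$, $B_{\mu\alpha}=\sum_{i=1}^4\mu_i\alpha_{i+4}$. *)

theory Defs
  imports "HOL-Analysis.Finite_Cartesian_Product"
begin

section \<open>Free supercommutative algebras\<close>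

class supervar = finite + linorder +
  fixes odd_var :: "'a \<Rightarrow> bool"

text \<open>
  A monomial is an exponent function; it stands for the product of the powers of the
  variables in increasing order of the variables. Odd variables square to zero.
\<close>

definition admissible :: "('v::supervar \<Rightarrow> nat) \<Rightarrow> bool" where
  "admissible m \<longleftrightarrow> (\<forall>v. odd_var v \<longrightarrow> m v \<le> 1)"

typedef (overloaded) ('v::supervar, 'k::zero) spoly =
  "{f :: ('v \<Rightarrow> nat) \<Rightarrow> 'k. finite {m. f m \<noteq> 0} \<and> (\<forall>m. f m \<noteq> 0 \<longrightarrow> admissible m)}"
  morphisms coeff Abs_spoly
  by (rule exI[of _ "\<lambda>_. 0"]) auto

setup_lifting type_definition_spoly

text \<open>The number of transpositions of odd variables needed to sort the product of the
  monomials \<open>p\<close> and \<open>q\<close>.\<close>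

definition swaps :: "('v::supervar \<Rightarrow> nat) \<Rightarrow> ('v \<Rightarrow> nat) \<Rightarrow> nat" where
  "swaps p q = (\<Sum>w | odd_var w. \<Sum>v | odd_var v \<and> v < w. p w * q v)"

definition splits :: "('v::supervar \<Rightarrow> nat) \<Rightarrow> (('v \<Rightarrow> nat) \<times> ('v \<Rightarrow> nat)) set" where
  "splits m = {(p, q). (\<lambda>v. p v + q v) = m}"

lemma finite_splits [simp]: "finite (splits m)"
proof -
  have "finite {p. \<forall>v. p v \<le> m v}"
  proof -
    have "finite (PiE UNIV (\<lambda>v. {..m v}))" by (rule finite_PiE) simp_all
    moreover have "{p. \<forall>v. p v \<le> m v} = PiE UNIV (\<lambda>v. {..m v})" by (simp add: PiE_UNIV_domain Pi_def)
    ultimately show ?thesis by simp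
  qed
  then have "finite ({p. \<forall>v. p v \<le> m v} \<times> {p. \<forall>v. p v \<le> m v})"
    by (intro finite_cartesian_product)
  moreover have "splits m \<subseteq> {p. \<forall>v. p v \<le> m v} \<times> {p. \<forall>v. p v \<le> m v}"
    by (auto simp: splits_def)
  ultimately show ?thesis by (rule rev_finite_subset)
qed

lemma coeff_inject_ext: "(\<And>m. coeff f m = coeff g m) \<Longrightarrow> f = g"
  by (metis coeff_inject ext)

lemma finite_supp [simp]: "finite {m. coeff f m \<noteq> 0}"
  using coeff[of f] by auto

lemma coeff_not_admissible: "\<not> admissible m \<Longrightarrow> coeff f m = 0"
  using coeff[of f] by auto

definition mono_coeff :: "('v::supervar \<Rightarrow> nat) \<Rightarrow> 'k \<Rightarrow> ('v \<Rightarrow> nat) \<Rightarrow> 'k::zero" where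
  "mono_coeff p c m = (if m = p \<and> admissible p then c else 0)"

instantiation spoly :: (supervar, comm_ring_1) ring_1
begin

lift_definition zero_spoly :: "('a, 'b) spoly" is "\<lambda>_. 0" by simp

lift_definition one_spoly :: "('a, 'b) spoly" is "mono_coeff (\<lambda>_. 0) 1"
  by (auto simp: mono_coeff_def)

lift_definition plus_spoly :: "('a, 'b) spoly \<Rightarrow> ('a, 'b) spoly \<Rightarrow> ('a, 'b) spoly"
  is "\<lambda>f g m. f m + g m"
proof -
  fix f g :: "('a \<Rightarrow> nat) \<Rightarrow> 'b"
  assume f: "finite {m. f m \<noteq> 0} \<and> (\<forall>m. f m \<noteq> 0 \<longrightarrow> admissible m)"
    and g: "finite {m. g m \<noteq> 0} \<and> (\<forall>m. g m \<noteq> 0 \<longrightarrow> admissible m)"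
  have "finite ({m. f m \<noteq> 0} \<union> {m. g m \<noteq> 0})" using f g by (simp only: finite_Un)
  then have "finite {m. f m + g m \<noteq> 0}" by (rule rev_finite_subset) auto
  moreover have "\<forall>m. f m + g m \<noteq> 0 \<longrightarrow> admissible m"
    using f g by (metis add.right_neutral)
  ultimately show "finite {m. f m + g m \<noteq> 0} \<and> (\<forall>m. f m + g m \<noteq> 0 \<longrightarrow> admissible m)" by blast
qed

lift_definition uminus_spoly :: "('a, 'b) spoly \<Rightarrow> ('a, 'b) spoly" is "\<lambda>f m. - f m" by simp

definition minus_spoly :: "('a, 'b) spoly \<Rightarrow> ('a, 'b) spoly \<Rightarrow> ('a, 'b) spoly"
  where "minus_spoly f g = f + - g"

lift_definition times_spoly :: "('a, 'b) spoly \<Rightarrow> ('a, 'b) spoly \<Rightarrow> ('a, 'b) spoly"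
  is "\<lambda>f g m. if admissible m then \<Sum>(p, q)\<in>splits m. (-1) ^ swaps p q * f p * g q else 0"
proof -
  fix f g :: "('a \<Rightarrow> nat) \<Rightarrow> 'b"
  let ?h = "\<lambda>m. if admissible m then \<Sum>(p, q)\<in>splits m. (-1) ^ swaps p q * f p * g q else 0"
  assume f: "finite {m. f m \<noteq> 0} \<and> (\<forall>m. f m \<noteq> 0 \<longrightarrow> admissible m)"
    and g: "finite {m. g m \<noteq> 0} \<and> (\<forall>m. g m \<noteq> 0 \<longrightarrow> admissible m)"
  have "finite ((\<lambda>(p, q) v. p v + q v) ` ({m. f m \<noteq> 0} \<times> {m. g m \<noteq> 0}))" (is "finite ?I")
    by (intro finite_imageI finite_cartesian_product) (use f g in simp_all)
  moreover have "{m. ?h m \<noteq> 0} \<subseteq> ?I"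
  proof
    fix m assume "m \<in> {m. ?h m \<noteq> 0}"
    then have "(\<Sum>(p, q)\<in>splits m. (-1) ^ swaps p q * f p * g q) \<noteq> 0" by (simp split: if_splits)
    then obtain x where x: "x \<in> splits m" "(case x of (p, q) \<Rightarrow> (-1) ^ swaps p q * f p * g q) \<noteq> 0"
      by (meson sum.not_neutral_contains_not_neutral)
    obtain p q where pq: "x = (p, q)" by force
    from x have "f p \<noteq> 0" "g q \<noteq> 0" "m = (\<lambda>v. p v + q v)" by (auto simp: pq splits_def)
    then show "m \<in> ?I" by (intro image_eqI[of _ _ "(p, q)"]) simp_all
  qed
  ultimately have "finite {m. ?h m \<noteq> 0}" by (rule rev_finite_subset)
  moreover have "\<forall>m. ?h m \<noteq> 0 \<longrightarrow> admissible m"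
    by (rule allI, case_tac "admissible m") (simp_all only: if_False simp_thms)
  ultimately show "finite {m. ?h m \<noteq> 0} \<and> (\<forall>m. ?h m \<noteq> 0 \<longrightarrow> admissible m)"
    by (rule conjI)
qed

lemma swaps_add_left: "swaps (\<lambda>v. p v + q v) r = swaps p r + swaps q r"
  by (simp add: swaps_def sum.distrib distrib_right distrib_left)

lemma swaps_add_right: "swaps r (\<lambda>v. p v + q v) = swaps r p + swaps r q"
  by (simp add: swaps_def sum.distrib distrib_right distrib_left)

lemma swaps_zero [simp]: "swaps (\<lambda>_. 0) r = 0" "swaps r (\<lambda>_. 0) = 0"
  by (simp_all add: swaps_def)

lemma admissible_split:
  assumes "admissible m" "(p, q) \<in> splits m"
  shows "admissible p" "admissible q"
proof -
  have le: "p v \<le> m v" "q v \<le> m v" for v using assms(2) by (auto simp: splits_def)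
  show "admissible p" "admissible q"
    using assms(1) le_trans[OF le(1)] le_trans[OF le(2)] by (simp_all add: admissible_def)
qed

lemma coeff_times:
  "admissible m \<Longrightarrow> coeff (a * b :: ('a, 'b) spoly) m =
    (\<Sum>x\<in>splits m. (-1) ^ swaps (fst x) (snd x) * coeff a (fst x) * coeff b (snd x))"
  by (simp add: times_spoly.rep_eq split_beta)

instance
proof
  fix a b c :: "('a, 'b) spoly"
  show "a + b + c = a + (b + c)" by transfer (simp add: add.assoc)
  show "a + b = b + a" by transfer (simp add: add.commute)
  show "0 + a = a" by transfer simp
  show "- a + a = 0" by transfer simp
  show "a - b = a + - b" by (simp add: minus_spoly_def)
  show "(a + b) * c = a * c + b * c"
    by transfer (auto simp: fun_eq_iff distrib_left distrib_right sum.distrib split_beta)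
  show "a * (b + c) = a * b + a * c"
    by transfer (auto simp: fun_eq_iff distrib_left distrib_right sum.distrib split_beta)
  show "(0 :: ('a, 'b) spoly) \<noteq> 1"
    by transfer (auto simp: mono_coeff_def fun_eq_iff admissible_def)
  show "1 * a = a"
  proof (rule coeff_inject_ext)
    fix m
    show "coeff (1 * a) m = coeff a m"
    proof (cases "admissible m")
      case True
      have "coeff (1 * a) m = (\<Sum>(p, q)\<in>splits m. (-1) ^ swaps p q * mono_coeff (\<lambda>_. 0) 1 p * coeff a q)"
        using True by (simp add: times_spoly.rep_eq one_spoly.rep_eq)
      also have "\<dots> = (\<Sum>x\<in>{((\<lambda>_. 0), m)}. case x of (p, q) \<Rightarrow> (-1) ^ swaps p q * mono_coeff (\<lambda>_. 0) 1 p * coeff a q)"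
        by (rule sum.mono_neutral_right[OF finite_splits])
          (auto simp: splits_def mono_coeff_def split: if_splits)
      also have "\<dots> = coeff a m" by (simp add: mono_coeff_def admissible_def)
      finally show ?thesis .
    qed (simp add: coeff_not_admissible)
  qed
  show "a * 1 = a"
  proof (rule coeff_inject_ext)
    fix m
    show "coeff (a * 1) m = coeff a m"
    proof (cases "admissible m")
      case True
      have "coeff (a * 1) m = (\<Sum>(p, q)\<in>splits m. (-1) ^ swaps p q * coeff a p * mono_coeff (\<lambda>_. 0) 1 q)"
        using True by (simp add: times_spoly.rep_eq one_spoly.rep_eq)
      also have "\<dots> = (\<Sum>x\<in>{(m, (\<lambda>_. 0))}. case x of (p, q) \<Rightarrow> (-1) ^ swaps p q * coeff a p * mono_coeff (\<lambda>_. 0) 1 q)"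
        by (rule sum.mono_neutral_right[OF finite_splits])
          (auto simp: splits_def mono_coeff_def split: if_splits)
      also have "\<dots> = coeff a m" by (simp add: mono_coeff_def admissible_def)
      finally show ?thesis .
    qed (simp add: coeff_not_admissible)
  qed
  show "a * b * c = a * (b * c)"
  proof (rule coeff_inject_ext)
    fix m
    show "coeff (a * b * c) m = coeff (a * (b * c)) m"
    proof (cases "admissible m")
      case True
      let ?F = "\<lambda>p q r. (-1) ^ (swaps p q + swaps p r + swaps q r) * coeff a p * coeff b q * coeff c r"
      have "coeff (a * b * c) m = (\<Sum>x\<in>splits m. \<Sum>y\<in>splits (fst x). ?F (fst y) (snd y) (snd x))"
        unfolding coeff_times[OF True]
      proof (rule sum.cong[OF refl])
        fix x assume x: "x \<in> splits m"
        have adm: "admissible (fst x)" using admissible_split(1)[OF True, of "fst x" "snd x"] x by simp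
        show "(-1) ^ swaps (fst x) (snd x) * coeff (a * b) (fst x) * coeff c (snd x) =
              (\<Sum>y\<in>splits (fst x). ?F (fst y) (snd y) (snd x))"
          unfolding coeff_times[OF adm] sum_distrib_left sum_distrib_right
        proof (rule sum.cong[OF refl])
          fix y assume "y \<in> splits (fst x)"
          then have "swaps (fst x) (snd x) = swaps (fst y) (snd x) + swaps (snd y) (snd x)"
            using swaps_add_left[of "fst y" "snd y" "snd x"] by (simp add: splits_def split_beta)
          then show "(-1) ^ swaps (fst x) (snd x) *
              ((-1) ^ swaps (fst y) (snd y) * coeff a (fst y) * coeff b (snd y)) * coeff c (snd x) =
              ?F (fst y) (snd y) (snd x)"
            by (simp add: power_add mult_ac)
        qed
      qed
      also have "\<dots> = (\<Sum>(x, y)\<in>Sigma (splits m) (\<lambda>x. splits (fst x)). ?F (fst y) (snd y) (snd x))"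
        by (rule sum.Sigma) simp_all
      also have "\<dots> = (\<Sum>(x, y)\<in>Sigma (splits m) (\<lambda>x. splits (snd x)). ?F (fst x) (fst y) (snd y))"
        by (rule sum.reindex_bij_witness
            [of _ "\<lambda>((p, s), (q, r)). (((\<lambda>v. p v + q v), r), (p, q))"
                  "\<lambda>((s, r), (p, q)). ((p, (\<lambda>v. q v + r v)), (q, r))"])
          (auto simp: splits_def add.assoc)
      also have "\<dots> = (\<Sum>x\<in>splits m. \<Sum>y\<in>splits (snd x). ?F (fst x) (fst y) (snd y))"
        by (rule sum.Sigma[symmetric]) simp_all
      also have "\<dots> = coeff (a * (b * c)) m"
        unfolding coeff_times[OF True]
      proof (rule sum.cong[OF refl])
        fix x assume x: "x \<in> splits m"
        have adm: "admissible (snd x)" using admissible_split(2)[OF True, of "fst x" "snd x"] x by simp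
        show "(\<Sum>y\<in>splits (snd x). ?F (fst x) (fst y) (snd y)) =
            (-1) ^ swaps (fst x) (snd x) * coeff a (fst x) * coeff (b * c) (snd x)"
          unfolding coeff_times[OF adm] sum_distrib_left sum_distrib_right
        proof (rule sum.cong[OF refl])
          fix y assume "y \<in> splits (snd x)"
          then have "swaps (fst x) (snd x) = swaps (fst x) (fst y) + swaps (fst x) (snd y)"
            using swaps_add_right[of "fst x" "fst y" "snd y"] by (simp add: splits_def split_beta)
          then show "?F (fst x) (fst y) (snd y) = (-1) ^ swaps (fst x) (snd x) * coeff a (fst x) *
              ((-1) ^ swaps (fst y) (snd y) * coeff b (fst y) * coeff c (snd y))"
            by (simp add: power_add mult_ac)
        qed
      qed
      finally show ?thesis .
    qed (simp add: coeff_not_admissible)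
  qed
qed

end

lift_definition monom :: "('v::supervar \<Rightarrow> nat) \<Rightarrow> 'k \<Rightarrow> ('v, 'k::zero) spoly" is mono_coeff
  by (auto simp: mono_coeff_def)

definition Var :: "'v::supervar \<Rightarrow> ('v, 'k::comm_ring_1) spoly" where
  "Var v = monom (\<lambda>w. if w = v then 1 else 0) 1"

definition const :: "'k::comm_ring_1 \<Rightarrow> ('v::supervar, 'k) spoly" where
  "const c = monom (\<lambda>_. 0) c"

definition odd_deg :: "('v::supervar \<Rightarrow> nat) \<Rightarrow> nat" where
  "odd_deg m = (\<Sum>v | odd_var v. m v)"

text \<open>Homogeneous components; the parity \<open>True\<close> is odd.\<close>

lift_definition hpart :: "bool \<Rightarrow> ('v::supervar, 'k::comm_ring_1) spoly \<Rightarrow> ('v, 'k) spoly"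
  is "\<lambda>b f m. if odd (odd_deg m) = b then f m else 0"
proof -
  fix b and f :: "('v \<Rightarrow> nat) \<Rightarrow> 'k"
  assume f: "finite {m. f m \<noteq> 0} \<and> (\<forall>m. f m \<noteq> 0 \<longrightarrow> admissible m)"
  have "finite {m. (if odd (odd_deg m) = b then f m else 0) \<noteq> 0}"
    by (rule finite_subset[OF _ conjunct1[OF f]]) auto
  with f show "finite {m. (if odd (odd_deg m) = b then f m else 0) \<noteq> 0} \<and>
      (\<forall>m. (if odd (odd_deg m) = b then f m else 0) \<noteq> 0 \<longrightarrow> admissible m)"
    by simp
qed

text \<open>For homogeneous \<open>f\<close>, \<open>twist b f\<close> is \<open>f\<close> multiplied by the sign for moving \<open>f\<close> past
  an element of parity \<open>b\<close>.\<close>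

definition twist :: "bool \<Rightarrow> ('v::supervar, 'k::comm_ring_1) spoly \<Rightarrow> ('v, 'k) spoly" where
  "twist b f = (if b then hpart False f - hpart True f else f)"

text \<open>The algebra homomorphism sending each variable \<open>v\<close> to \<open>\<phi> v\<close>; it is one if
  \<open>\<phi>\<close> is supercommuting, see \<open>subst_mult\<close> below.\<close>

definition eval_monom :: "('v::supervar \<Rightarrow> 'a::ring_1) \<Rightarrow> ('v \<Rightarrow> nat) \<Rightarrow> 'a" where
  "eval_monom \<phi> m = prod_list (map (\<lambda>v. \<phi> v ^ m v) (sorted_list_of_set UNIV))"

definition subst :: "('v::supervar \<Rightarrow> ('w::supervar, 'k::comm_ring_1) spoly) \<Rightarrow>
    ('v, 'k) spoly \<Rightarrow> ('w, 'k) spoly" where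
  "subst \<phi> f = (\<Sum>m | coeff f m \<noteq> 0. const (coeff f m) * eval_monom \<phi> m)"

definition supercommuting :: "('v::supervar \<Rightarrow> 'a::ring_1) \<Rightarrow> bool" where
  "supercommuting \<phi> \<longleftrightarrow>
    (\<forall>v w. \<phi> v * \<phi> w = (if odd_var v \<and> odd_var w then - (\<phi> w * \<phi> v) else \<phi> w * \<phi> v)) \<and>
    (\<forall>v. odd_var v \<longrightarrow> \<phi> v * \<phi> v = 0)"


subsection \<open>Basic properties\<close>

lemma coeff_ring_simps [simp]:
  "coeff (0 :: ('v::supervar, 'k::comm_ring_1) spoly) m = 0"
  "coeff (f + g :: ('v::supervar, 'k::comm_ring_1) spoly) m = coeff f m + coeff g m"
  "coeff (f - g :: ('v::supervar, 'k::comm_ring_1) spoly) m = coeff f m - coeff g m"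
  "coeff (- f :: ('v::supervar, 'k::comm_ring_1) spoly) m = - coeff f m"
  unfolding minus_spoly_def zero_spoly.rep_eq plus_spoly.rep_eq uminus_spoly.rep_eq by simp_all

lemma coeff_sum: "coeff (sum F A :: ('v::supervar, 'k::comm_ring_1) spoly) m = (\<Sum>x\<in>A. coeff (F x) m)"
  by (induction A rule: infinite_finite_induct) simp_all

lemma coeff_monom: "coeff (monom p c) m = (if m = p \<and> admissible p then c else 0)"
  by (simp add: monom.rep_eq mono_coeff_def)

lemma coeff_twist: "coeff (twist b f) m = (if b \<and> odd (odd_deg m) then - coeff f m else coeff f m)"
  by (auto simp: twist_def hpart.rep_eq)

lemma monom_not_admissible: "\<not> admissible p \<Longrightarrow> monom p c = (0 :: ('v::supervar, 'k::comm_ring_1) spoly)"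
  by (rule coeff_inject_ext) (simp add: coeff_monom)

lemma monom_mult:
  fixes c d :: "'k::comm_ring_1"
  shows "monom p c * monom q d = monom (\<lambda>v. p v + q v) ((-1) ^ swaps p q * c * d)"
proof (rule coeff_inject_ext)
  fix m
  show "coeff (monom p c * monom q d) m = coeff (monom (\<lambda>v. p v + q v) ((-1) ^ swaps p q * c * d)) m"
  proof (cases "admissible m")
    case True
    show ?thesis
    proof (cases "m = (\<lambda>v. p v + q v)")
      case m: True
      then have pq: "(p, q) \<in> splits m" by (simp add: splits_def)
      have "coeff (monom p c * monom q d) m =
          (\<Sum>x\<in>splits m. (-1) ^ swaps (fst x) (snd x) * coeff (monom p c) (fst x) * coeff (monom q d) (snd x))"
        by (rule coeff_times[OF True])
      also have "\<dots> = (\<Sum>x\<in>{(p, q)}. (-1) ^ swaps (fst x) (snd x) * coeff (monom p c) (fst x) * coeff (monom q d) (snd x))"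
        by (rule sum.mono_neutral_right) (use pq in \<open>auto simp: coeff_monom split: if_splits\<close>)
      also have "\<dots> = (-1) ^ swaps p q * c * d"
        using admissible_split[OF True pq] by (simp add: coeff_monom)
      also have "\<dots> = coeff (monom (\<lambda>v. p v + q v) ((-1) ^ swaps p q * c * d)) m"
        using True m by (simp add: coeff_monom)
      finally show ?thesis .
    next
      case False
      have "(-1) ^ swaps (fst x) (snd x) * coeff (monom p c) (fst x) * coeff (monom q d) (snd x) = 0"
        if "x \<in> splits m" for x
        using that False by (auto simp: coeff_monom splits_def)
      then have "coeff (monom p c * monom q d) m = 0"
        unfolding coeff_times[OF True] by (rule sum.neutral[OF ballI])
      with False show ?thesis by (simp add: coeff_monom)
    qed
  qed (simp add: coeff_not_admissible)
qed

lemma monom_add: "monom p (c + d) = monom p c + (monom p d :: ('v::supervar, 'k::comm_ring_1) spoly)"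
  by (rule coeff_inject_ext) (simp add: coeff_monom)

lemma monom_uminus: "monom p (- c) = - (monom p c :: ('v::supervar, 'k::comm_ring_1) spoly)"
  by (rule coeff_inject_ext) (simp add: coeff_monom)

lemma const_0 [simp]: "const 0 = (0 :: ('v::supervar, 'k::comm_ring_1) spoly)"
  by (rule coeff_inject_ext) (simp add: const_def coeff_monom)

lemma const_1 [simp]: "const 1 = (1 :: ('v::supervar, 'k::comm_ring_1) spoly)"
  by (rule coeff_inject_ext) (simp add: const_def coeff_monom one_spoly.rep_eq mono_coeff_def)

lemma const_add: "const (c + d) = const c + (const d :: ('v::supervar, 'k::comm_ring_1) spoly)"
  by (simp add: const_def monom_add)

lemma const_uminus: "const (- c) = - (const c :: ('v::supervar, 'k::comm_ring_1) spoly)"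
  by (simp add: const_def monom_uminus)

lemma const_mult: "const (c * d) = const c * (const d :: ('v::supervar, 'k::comm_ring_1) spoly)"
  by (simp add: const_def monom_mult)

lemma const_mult_monom: "const c * monom p d = monom p (c * d)"
  by (simp add: const_def monom_mult)

lemma monom_mult_const: "monom p d * const c = monom p (c * d)"
  by (simp add: const_def monom_mult mult.commute)

lemma spoly_decomp: "f = (\<Sum>m | coeff f m \<noteq> 0. monom m (coeff f m))"
  for f :: "('v::supervar, 'k::comm_ring_1) spoly"
proof (rule coeff_inject_ext)
  fix m
  have "coeff (\<Sum>m | coeff f m \<noteq> 0. monom m (coeff f m)) m =
      (\<Sum>n | coeff f n \<noteq> 0. if n = m then coeff f m else 0)"
    unfolding coeff_sum by (rule sum.cong) (auto simp: coeff_monom coeff_not_admissible)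
  also have "\<dots> = coeff f m" by (simp add: sum.delta)
  finally show "coeff f m = coeff (\<Sum>m | coeff f m \<noteq> 0. monom m (coeff f m)) m" by simp
qed

lemma const_commute: "const c * f = f * (const c :: ('v::supervar, 'k::comm_ring_1) spoly)"
  by (subst (1 2) spoly_decomp[of f])
    (simp add: sum_distrib_left sum_distrib_right const_mult_monom monom_mult_const)

lemma swaps_unit:
  "swaps (\<lambda>u. if u = v then 1 else 0) (\<lambda>u. if u = w then 1 else 0) =
    (if odd_var v \<and> odd_var w \<and> w < v then 1 else 0)"
proof -
  have "swaps (\<lambda>u. if u = v then 1 else 0) (\<lambda>u. if u = w then 1 else 0) =
    (\<Sum>x | odd_var x. \<Sum>y | odd_var y \<and> y < x. if y = w then (if x = v then 1 else 0) else 0)"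
    unfolding swaps_def by (intro sum.cong refl) simp
  also have "\<dots> = (\<Sum>x | odd_var x. if odd_var w \<and> w < x then (if x = v then 1 else 0) else 0)"
    by (intro sum.cong refl) (subst sum.delta, auto)
  also have "\<dots> = (\<Sum>x | odd_var x. if x = v then (if odd_var w \<and> w < v then 1 else 0) else 0)"
    by (intro sum.cong refl) auto
  also have "\<dots> = (if odd_var v \<and> odd_var w \<and> w < v then 1 else 0)"
    by (subst sum.delta) auto
  finally show ?thesis .
qed

lemma Var_square: "odd_var v \<Longrightarrow> Var v * Var v = (0 :: ('v::supervar, 'k::comm_ring_1) spoly)"
  by (simp add: Var_def monom_mult, rule monom_not_admissible) (auto simp: admissible_def intro!: exI[of _ v])

lemma Var_commute: "Var v * Var w =
    (if odd_var v \<and> odd_var w then - (Var w * Var v) else Var w * (Var v :: ('v::supervar, 'k::comm_ring_1) spoly))"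
proof (cases "v = w")
  case True
  then show ?thesis by (simp add: Var_square)
next
  case False
  then consider "v < w" | "w < v" by force
  then show ?thesis
    by cases (auto simp: Var_def monom_mult swaps_unit monom_uminus add.commute simp del: One_nat_def)
qed

lemma supercommuting_Var: "supercommuting (\<lambda>i. Var (h i))" if "\<And>i. odd_var (h i) = odd_var i"
  unfolding supercommuting_def using that Var_commute Var_square by metis


subsection \<open>Substitution is a homomorphism\<close>

lemma subst_superset:
  assumes "finite M" "{m. coeff f m \<noteq> 0} \<subseteq> M"
  shows "subst \<phi> f = (\<Sum>m\<in>M. const (coeff f m) * eval_monom \<phi> m)"
  unfolding subst_def by (rule sum.mono_neutral_left) (use assms in auto)

lemma subst_0 [simp]: "subst \<phi> 0 = 0"
  by (simp add: subst_def)

lemma subst_add: "subst \<phi> (f + g) = subst \<phi> f + subst \<phi> g"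
proof -
  let ?M = "{m. coeff f m \<noteq> 0} \<union> {m. coeff g m \<noteq> 0}"
  have fin: "finite ?M" by simp
  have "{m. coeff (f + g) m \<noteq> 0} \<subseteq> ?M" by auto
  then have "subst \<phi> (f + g) = (\<Sum>m\<in>?M. const (coeff (f + g) m) * eval_monom \<phi> m)"
    by (rule subst_superset[OF fin])
  also have "\<dots> = (\<Sum>m\<in>?M. const (coeff f m) * eval_monom \<phi> m) + (\<Sum>m\<in>?M. const (coeff g m) * eval_monom \<phi> m)"
    by (simp add: const_add distrib_right sum.distrib)
  also have "\<dots> = subst \<phi> f + subst \<phi> g"
    by (subst (1 2) subst_superset[OF fin]) auto
  finally show ?thesis .
qed

lemma subst_sum: "subst \<phi> (sum F A) = (\<Sum>x\<in>A. subst \<phi> (F x))"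
  by (induction A rule: infinite_finite_induct) (simp_all add: subst_add)

lemma subst_uminus: "subst \<phi> (- f) = - subst \<phi> f"
  using subst_add[of \<phi> f "- f"] by (simp add: eq_neg_iff_add_eq_0 add.commute)

lemma subst_diff: "subst \<phi> (f - g) = subst \<phi> f - subst \<phi> g"
  using subst_add[of \<phi> f "- g"] by (simp add: subst_uminus)

lemma eval_monom_not_admissible:
  assumes "supercommuting \<phi>" "\<not> admissible m"
  shows "eval_monom \<phi> m = 0"
proof -
  obtain v where v: "odd_var v" "m v \<ge> 2" using assms(2) by (force simp: admissible_def)
  then obtain n where "m v = Suc (Suc n)" by (metis add_2_eq_Suc le_Suc_ex)
  moreover have "\<phi> v * \<phi> v = 0" using assms(1) v(1) unfolding supercommuting_def by blast
  ultimately have "\<phi> v ^ m v = 0" by (simp add: mult.assoc[symmetric])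
  moreover have "v \<in> set (sorted_list_of_set UNIV)" by simp
  then obtain xs ys where "sorted_list_of_set UNIV = xs @ v # ys" by (meson split_list)
  ultimately show ?thesis by (simp add: eval_monom_def)
qed

lemma subst_monom:
  assumes "supercommuting \<phi>"
  shows "subst \<phi> (monom m c) = const c * eval_monom \<phi> m"
proof (cases "admissible m")
  case True
  have "subst \<phi> (monom m c) = (\<Sum>n\<in>{m}. const (coeff (monom m c) n) * eval_monom \<phi> n)"
    by (rule subst_superset) (auto simp: coeff_monom)
  then show ?thesis using True by (simp add: coeff_monom)
qed (simp add: monom_not_admissible eval_monom_not_admissible[OF assms])

lemma supercommuting_power:
  fixes \<phi> :: "'v::supervar \<Rightarrow> 'a::ring_1"
  assumes "supercommuting \<phi>"
  shows "\<phi> v ^ a * \<phi> w ^ b = (-1) ^ (if odd_var v \<and> odd_var w then a * b else 0) * (\<phi> w ^ b * \<phi> v ^ a)"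
proof -
  define e :: 'a where "e = (if odd_var v \<and> odd_var w then -1 else 1)"
  have e: "e * x = x * e" for x by (simp add: e_def)
  have en: "e ^ n * x = x * e ^ n" for x n
    by (rule power_commuting_commutes) (rule e)
  have 0: "\<phi> v * \<phi> w = e * (\<phi> w * \<phi> v)"
  proof -
    have "\<phi> v * \<phi> w = (if odd_var v \<and> odd_var w then - (\<phi> w * \<phi> v) else \<phi> w * \<phi> v)"
      using assms unfolding supercommuting_def by blast
    then show ?thesis by (cases "odd_var v \<and> odd_var w") (simp_all only: e_def if_True if_False mult_1_left mult_minus1 simp_thms)
  qed
  have 1: "\<phi> v * \<phi> w ^ b = e ^ b * (\<phi> w ^ b * \<phi> v)" for b
  proof (induction b)
    case (Suc b)
    have "\<phi> v * \<phi> w ^ Suc b = (\<phi> v * \<phi> w) * \<phi> w ^ b" by (simp add: mult.assoc)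
    also have "\<dots> = e * (\<phi> w * (\<phi> v * \<phi> w ^ b))" by (simp add: 0 mult.assoc)
    also have "\<dots> = e * ((\<phi> w * e ^ b) * (\<phi> w ^ b * \<phi> v))" by (simp add: Suc mult.assoc)
    also have "\<dots> = e * ((e ^ b * \<phi> w) * (\<phi> w ^ b * \<phi> v))" by (simp only: en)
    finally show ?case by (simp add: mult.assoc)
  qed simp
  have "\<phi> v ^ a * \<phi> w ^ b = e ^ (a * b) * (\<phi> w ^ b * \<phi> v ^ a)"
  proof (induction a)
    case (Suc a)
    have "\<phi> v ^ Suc a * \<phi> w ^ b = \<phi> v * (\<phi> v ^ a * \<phi> w ^ b)" by (simp add: mult.assoc)
    also have "\<dots> = (\<phi> v * e ^ (a * b)) * (\<phi> w ^ b * \<phi> v ^ a)" by (simp add: Suc mult.assoc)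
    also have "\<dots> = e ^ (a * b) * ((\<phi> v * \<phi> w ^ b) * \<phi> v ^ a)" by (simp add: en[symmetric] mult.assoc)
    also have "\<dots> = (e ^ (a * b) * e ^ b) * (\<phi> w ^ b * \<phi> v ^ Suc a)" by (simp add: 1 mult.assoc)
    also have "e ^ (a * b) * e ^ b = e ^ (Suc a * b)" by (simp add: power_add[symmetric] add.commute)
    finally show ?case .
  qed simp
  then show ?thesis by (simp add: e_def split: if_splits)
qed

lemma minus_one_power_commute: "(-1 :: 'a::ring_1) ^ n * x = x * (-1) ^ n"
  by (rule power_commuting_commutes) simp

lemma supercommuting_prod_power:
  fixes \<phi> :: "'v::supervar \<Rightarrow> 'a::ring_1"
  assumes "supercommuting \<phi>"
  shows "prod_list (map (\<lambda>v. \<phi> v ^ p v) xs) * \<phi> w ^ b =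
    (-1) ^ (\<Sum>v\<leftarrow>xs. if odd_var v \<and> odd_var w then p v * b else 0) *
    (\<phi> w ^ b * prod_list (map (\<lambda>v. \<phi> v ^ p v) xs))"
proof (induction xs)
  case (Cons x xs)
  let ?P = "prod_list (map (\<lambda>v. \<phi> v ^ p v) xs)"
  let ?n = "\<Sum>v\<leftarrow>xs. if odd_var v \<and> odd_var w then p v * b else 0"
  let ?k = "if odd_var x \<and> odd_var w then p x * b else 0"
  have "\<phi> x ^ p x * ?P * \<phi> w ^ b = \<phi> x ^ p x * (-1) ^ ?n * (\<phi> w ^ b * ?P)"
    by (simp only: mult.assoc Cons)
  also have "\<dots> = ((-1) ^ ?n * \<phi> x ^ p x) * (\<phi> w ^ b * ?P)"
    by (simp only: minus_one_power_commute)
  also have "\<dots> = (-1) ^ ?n * ((\<phi> x ^ p x * \<phi> w ^ b) * ?P)"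
    by (simp only: mult.assoc)
  also have "\<dots> = ((-1) ^ ?n * (-1) ^ ?k) * (\<phi> w ^ b * (\<phi> x ^ p x * ?P))"
    unfolding supercommuting_power[OF assms, of x _ w] by (simp only: mult.assoc)
  also have "(-1) ^ ?n * (-1) ^ ?k = (-1 :: 'a) ^ (?k + ?n)"
    by (simp only: power_add[symmetric] add.commute)
  finally show ?case by simp
qed simp

lemma eval_monom_mult_aux:
  fixes \<phi> :: "'v::supervar \<Rightarrow> 'a::ring_1"
  assumes "supercommuting \<phi>" "sorted xs" "distinct xs"
  shows "prod_list (map (\<lambda>v. \<phi> v ^ p v) xs) * prod_list (map (\<lambda>v. \<phi> v ^ q v) xs) =
    (-1) ^ (\<Sum>w\<leftarrow>xs. \<Sum>v\<leftarrow>xs. if odd_var w \<and> odd_var v \<and> v < w then p w * q v else 0) *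
    prod_list (map (\<lambda>v. \<phi> v ^ (p v + q v)) xs)"
  using assms(2,3)
proof (induction xs)
  case (Cons x xs)
  let ?P = "\<lambda>p. prod_list (map (\<lambda>v. \<phi> v ^ p v) xs)"
  let ?n = "\<Sum>v\<leftarrow>xs. if odd_var v \<and> odd_var x then p v * q x else 0"
  let ?k = "\<Sum>w\<leftarrow>xs. \<Sum>v\<leftarrow>xs. if odd_var w \<and> odd_var v \<and> v < w then p w * q v else 0"
  have lt: "x < v" if "v \<in> set xs" for v using Cons.prems that by (auto simp: order.strict_iff_order)
  have "\<phi> x ^ p x * ?P p * (\<phi> x ^ q x * ?P q) = \<phi> x ^ p x * (?P p * \<phi> x ^ q x) * ?P q"
    by (simp only: mult.assoc)
  also have "\<dots> = (\<phi> x ^ p x * (-1) ^ ?n) * (\<phi> x ^ q x * (?P p * ?P q))"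
    unfolding supercommuting_prod_power[OF assms(1)] by (simp only: mult.assoc)
  also have "\<dots> = ((-1) ^ ?n * \<phi> x ^ p x) * (\<phi> x ^ q x * (?P p * ?P q))"
    by (simp only: minus_one_power_commute)
  also have "\<dots> = (-1) ^ ?n * (\<phi> x ^ (p x + q x) * (?P p * ?P q))"
    by (simp only: mult.assoc power_add)
  also have "?P p * ?P q = (-1) ^ ?k * ?P (\<lambda>v. p v + q v)"
    using Cons by simp
  also have "(-1) ^ ?n * (\<phi> x ^ (p x + q x) * ((-1) ^ ?k * ?P (\<lambda>v. p v + q v))) =
      (-1) ^ ?n * ((\<phi> x ^ (p x + q x) * (-1) ^ ?k) * ?P (\<lambda>v. p v + q v))"
    by (simp only: mult.assoc)
  also have "\<dots> = (-1) ^ ?n * (((-1) ^ ?k * \<phi> x ^ (p x + q x)) * ?P (\<lambda>v. p v + q v))"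
    by (simp only: minus_one_power_commute)
  also have "\<dots> = (-1) ^ (?n + ?k) * (\<phi> x ^ (p x + q x) * ?P (\<lambda>v. p v + q v))"
    by (simp only: mult.assoc power_add)
  also have "?n + ?k = (\<Sum>w\<leftarrow>x#xs. \<Sum>v\<leftarrow>x#xs. if odd_var w \<and> odd_var v \<and> v < w then p w * q v else 0)"
  proof -
    have 1: "(\<Sum>v\<leftarrow>xs. if odd_var x \<and> odd_var v \<and> v < x then p x * q v else 0) = 0"
      using lt by (auto simp: sum_list_eq_0_iff dest: less_asym)
    have 2: "(\<Sum>w\<leftarrow>xs. (if odd_var w \<and> odd_var x \<and> x < w then p w * q x else 0) + f w) = ?n + (\<Sum>w\<leftarrow>xs. f w)" for f
      unfolding sum_list_addf using lt
      by (intro arg_cong2[where f = "(+)"] refl arg_cong[where f = sum_list] map_cong) auto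
    show ?thesis by (simp add: 1 2)
  qed
  finally show ?case by simp
qed simp

lemma eval_monom_mult:
  assumes "supercommuting \<phi>"
  shows "eval_monom \<phi> p * eval_monom \<phi> q = (-1) ^ swaps p q * eval_monom \<phi> (\<lambda>v. p v + q v)"
proof -
  have sum: "(\<Sum>v\<leftarrow>sorted_list_of_set UNIV. f v) = (\<Sum>v\<in>UNIV. f v)" for f :: "'a \<Rightarrow> nat"
    by (subst sum_list_distinct_conv_sum_set) simp_all
  have "swaps p q = (\<Sum>w\<in>UNIV. \<Sum>v\<in>UNIV. if odd_var w \<and> odd_var v \<and> v < w then p w * q v else 0)"
  proof -
    have "(\<Sum>v | odd_var v \<and> v < w. p w * q v) =
        (\<Sum>v\<in>UNIV. if odd_var v \<and> v < w then p w * q v else 0)" for w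
      by (rule sum.mono_neutral_cong_left) auto
    then show ?thesis
      unfolding swaps_def by (intro sum.mono_neutral_cong_left) auto
  qed
  then show ?thesis
    unfolding eval_monom_def
    by (subst eval_monom_mult_aux[OF assms]) (simp_all add: sum)
qed

lemma const_minus_one_power: "const ((-1) ^ n) = ((-1) ^ n :: ('v::supervar, 'k::comm_ring_1) spoly)"
  by (induction n) (simp_all add: const_uminus)

lemma subst_mult:
  assumes "supercommuting \<phi>"
  shows "subst \<phi> (f * g) = subst \<phi> f * subst \<phi> g"
proof -
  have mono: "subst \<phi> (monom p c * monom q d) = subst \<phi> (monom p c) * subst \<phi> (monom q d)" for p q c d
  proof -
    have "subst \<phi> (monom p c * monom q d) = const c * const d * ((-1) ^ swaps p q * eval_monom \<phi> (\<lambda>v. p v + q v))"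
      unfolding monom_mult subst_monom[OF assms] const_mult const_minus_one_power
      by (simp only: mult.assoc minus_one_power_commute)
    also have "\<dots> = const c * (const d * eval_monom \<phi> p) * eval_monom \<phi> q"
      by (simp only: eval_monom_mult[OF assms, symmetric] mult.assoc)
    also have "\<dots> = subst \<phi> (monom p c) * subst \<phi> (monom q d)"
      by (simp only: const_commute[of d "eval_monom \<phi> p"] subst_monom[OF assms] mult.assoc)
    finally show ?thesis .
  qed
  show ?thesis
    by (subst (1 2) spoly_decomp[of f], subst (1 2) spoly_decomp[of g])
      (simp only: sum_distrib_left sum_distrib_right subst_sum mono)
qed

lemma prod_list_map_unit:
  "distinct xs \<Longrightarrow> v \<in> set xs \<Longrightarrow>
    prod_list (map (\<lambda>u. \<phi> u ^ (if u = v then 1 else 0)) xs) = (\<phi> v :: 'a::ring_1)"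
proof (induction xs)
  case (Cons x xs)
  show ?case
  proof (cases "x = v")
    case True
    with Cons.prems have "\<forall>u\<in>set xs. u \<noteq> v" by auto
    then have "prod_list (map (\<lambda>u. \<phi> u ^ (if u = v then 1 else 0)) xs) = 1"
      by (induction xs) auto
    with True show ?thesis by simp
  next
    case False
    with Cons show ?thesis by simp
  qed
qed simp

lemma subst_Var: "supercommuting \<phi> \<Longrightarrow> subst \<phi> (Var v) = \<phi> v"
  unfolding Var_def by (subst subst_monom) (simp_all add: eval_monom_def prod_list_map_unit del: One_nat_def)

lemma subst_const: "supercommuting \<phi> \<Longrightarrow> subst \<phi> (const c) = const c"
  unfolding const_def by (subst subst_monom) (simp_all add: eval_monom_def const_def map_replicate_const)

lemma odd_deg_add: "odd_deg (\<lambda>v. p v + q v) = odd_deg p + odd_deg q"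
  by (simp add: odd_deg_def sum.distrib)

lemma twist_add: "twist b (f + g) = twist b f + twist b g"
  by (rule coeff_inject_ext) (simp add: coeff_twist)

lemma twist_0 [simp]: "twist b 0 = 0"
  by (rule coeff_inject_ext) (simp add: coeff_twist)

lemma twist_twist [simp]: "twist b (twist b f) = f"
  by (rule coeff_inject_ext) (simp add: coeff_twist)

lemma twist_False [simp]: "twist False f = f"
  by (simp add: twist_def)

lemma twist_1 [simp]: "twist b 1 = 1"
  by (rule coeff_inject_ext) (auto simp: coeff_twist one_spoly.rep_eq mono_coeff_def odd_deg_def)

lemma twist_Var: "twist b (Var v) = (if b \<and> odd_var v then - Var v else Var v)"
proof -
  have "odd_deg (\<lambda>w. if w = v then 1 else 0) = (if odd_var v then 1 else 0)"
    unfolding odd_deg_def by (subst sum.delta) auto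
  then show ?thesis
    by (intro coeff_inject_ext) (auto simp: coeff_twist Var_def coeff_monom split: if_splits)
qed

lemma twist_mult: "twist b (f * g) = twist b f * twist b g"
proof (rule coeff_inject_ext)
  fix m
  show "coeff (twist b (f * g)) m = coeff (twist b f * twist b g) m"
  proof (cases "admissible m")
    case True
    define s :: "('a \<Rightarrow> nat) \<Rightarrow> 'b" where "s p = (if b then (-1) ^ odd_deg p else 1)" for p
    have tw: "coeff (twist b h) p = s p * coeff h p" for h p
      by (auto simp: coeff_twist s_def)
    have "coeff (twist b (f * g)) m =
        (\<Sum>x\<in>splits m. s m * ((-1) ^ swaps (fst x) (snd x) * coeff f (fst x) * coeff g (snd x)))"
      by (simp add: tw coeff_times[OF True] sum_distrib_left)
    also have "\<dots> = (\<Sum>x\<in>splits m. (-1) ^ swaps (fst x) (snd x) * coeff (twist b f) (fst x) * coeff (twist b g) (snd x))"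
    proof (rule sum.cong[OF refl])
      fix x assume "x \<in> splits m"
      then have "odd_deg m = odd_deg (fst x) + odd_deg (snd x)"
        using odd_deg_add[of "fst x" "snd x"] by (simp add: splits_def split_beta)
      then have "s m = s (fst x) * s (snd x)" by (simp add: s_def power_add)
      then show "s m * ((-1) ^ swaps (fst x) (snd x) * coeff f (fst x) * coeff g (snd x)) =
          (-1) ^ swaps (fst x) (snd x) * coeff (twist b f) (fst x) * coeff (twist b g) (snd x)"
        by (simp add: tw mult_ac)
    qed
    also have "\<dots> = coeff (twist b f * twist b g) m" by (simp add: coeff_times[OF True])
    finally show ?thesis .
  qed (simp add: coeff_not_admissible)
qed


lemma monom_Var_commute:
  "monom p c * Var v = (if odd_var v \<and> odd (odd_deg p) then - (Var v * monom p c)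
    else Var v * (monom p c :: ('v::supervar, 'k::comm_ring_1) spoly))"
proof -
  let ?u = "\<lambda>w. if w = v then 1 else (0::nat)"
  have pu: "swaps p ?u = (if odd_var v then (\<Sum>w | odd_var w \<and> v < w. p w) else 0)"
  proof -
    have "(\<Sum>x | odd_var x \<and> x < w. p w * ?u x) = (if odd_var v \<and> v < w then p w else 0)" for w
      by (simp add: if_distrib[of "\<lambda>x. _ * x"] sum.delta cong: if_cong)
    then show ?thesis
      unfolding swaps_def by (auto intro!: sum.mono_neutral_cong_right split: if_splits)
  qed
  have up: "swaps ?u p = (if odd_var v then (\<Sum>w | odd_var w \<and> w < v. p w) else 0)"
  proof -
    have "swaps ?u p = (\<Sum>w | odd_var w. if w = v then (\<Sum>x | odd_var x \<and> x < v. p x) else 0)"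
      unfolding swaps_def by (intro sum.cong refl) simp
    then show ?thesis by (simp add: sum.delta)
  qed
  have comm: "(\<lambda>w. ?u w + p w) = (\<lambda>w. p w + ?u w)" by (simp add: add.commute)
  show ?thesis
  proof (cases "odd_var v")
    case False
    then show ?thesis by (simp add: Var_def monom_mult pu up comm del: One_nat_def)
  next
    case True
    show ?thesis
    proof (cases "p v = 0")
      case False
      with True have "\<not> admissible (\<lambda>w. p w + ?u w)"
        by (auto simp: admissible_def intro!: exI[of _ v])
      then show ?thesis by (simp add: Var_def monom_mult comm monom_not_admissible del: One_nat_def)
    next
      case pv: True
      have "{w. odd_var w} = {w. odd_var w \<and> v < w} \<union> {w. odd_var w \<and> w < v} \<union> {v}"
        using True by auto
      then have "odd_deg p = (\<Sum>w\<in>{w. odd_var w \<and> v < w} \<union> {w. odd_var w \<and> w < v} \<union> {v}. p w)"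
        by (simp add: odd_deg_def)
      also have "\<dots> = swaps p ?u + swaps ?u p"
        unfolding pu up using True pv by (subst sum.union_disjoint; (subst sum.union_disjoint)?; auto)
      finally have deg: "odd_deg p = swaps p ?u + swaps ?u p" .
      have "(-1 :: 'k) ^ swaps p ?u = (-1) ^ odd_deg p * (-1) ^ swaps ?u p"
        by (simp add: deg power_add mult.assoc flip: power_mult_distrib)
      then show ?thesis using True
        by (simp add: Var_def monom_mult comm monom_uminus del: One_nat_def)
    qed
  qed
qed

lemma mult_Var: "f * Var v = Var v * twist (odd_var v) f"
  for f :: "('v::supervar, 'k::comm_ring_1) spoly"
proof -
  have tw: "twist b (sum F A) = (\<Sum>x\<in>A. twist b (F x))" for b A and F :: "_ \<Rightarrow> ('v, 'k) spoly"
    by (induction A rule: infinite_finite_induct) (simp_all add: twist_add)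
  have "twist b (monom p c) = (if b \<and> odd (odd_deg p) then - monom p c else monom p c)"
    for b and p :: "'v \<Rightarrow> nat" and c :: 'k
    by (rule coeff_inject_ext) (auto simp: coeff_twist coeff_monom)
  then have "monom p c * Var v = Var v * twist (odd_var v) (monom p c)" for p and c :: 'k
    by (simp add: monom_Var_commute)
  then show ?thesis
    by (subst (1 2) spoly_decomp[of f]) (simp add: tw sum_distrib_left sum_distrib_right)
qed


section \<open>The Lie conformal superalgebra \<open>RW(4,4)\<close>\<close>

typedef ix = "{1..8 :: nat}" morphisms idx Ix
  by (rule exI[of _ 1]) simp

instantiation ix :: supervar
begin

definition less_eq_ix :: "ix \<Rightarrow> ix \<Rightarrow> bool" where "less_eq_ix i j \<longleftrightarrow> idx i \<le> idx j"
definition less_ix :: "ix \<Rightarrow> ix \<Rightarrow> bool" where "less_ix i j \<longleftrightarrow> idx i < idx j"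
definition odd_var_ix :: "ix \<Rightarrow> bool" where "odd_var_ix i \<longleftrightarrow> idx i \<ge> 5"

instance
proof
  have "(UNIV :: ix set) = Ix ` {1..8}"
    by (metis UNIV_eq_I idx idx_inverse image_eqI)
  then show "finite (UNIV :: ix set)" by (metis finite_imageI finite_atLeastAtMost)
qed (auto simp: less_eq_ix_def less_ix_def idx_inject)

end

datatype lvar = Lam ix | Del ix

fun lvar_pos :: "lvar \<Rightarrow> nat" where
  "lvar_pos (Lam i) = idx i"
| "lvar_pos (Del i) = idx i + 8"

lemma lvar_pos_inject: "lvar_pos x = lvar_pos y \<longleftrightarrow> x = y"
proof -
  have "1 \<le> idx i" "idx i \<le> 8" for i using idx[of i] by auto
  then have "idx i \<noteq> idx j + 8" for i j by (metis add_le_same_cancel2 le_trans not_one_le_zero)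
  then show ?thesis by (cases x; cases y) (auto simp: idx_inject dest: sym)
qed

instantiation lvar :: supervar
begin

definition less_eq_lvar :: "lvar \<Rightarrow> lvar \<Rightarrow> bool" where "less_eq_lvar x y \<longleftrightarrow> lvar_pos x \<le> lvar_pos y"
definition less_lvar :: "lvar \<Rightarrow> lvar \<Rightarrow> bool" where "less_lvar x y \<longleftrightarrow> lvar_pos x < lvar_pos y"
fun odd_var_lvar :: "lvar \<Rightarrow> bool" where
  "odd_var_lvar (Lam i) = odd_var i"
| "odd_var_lvar (Del i) = odd_var i"

instance
proof
  have "(UNIV :: lvar set) = range Lam \<union> range Del"
    by (auto intro: lvar.exhaust)
  then show "finite (UNIV :: lvar set)" by (metis finite_UnI finite_imageI finite)
qed (auto simp: less_eq_lvar_def less_lvar_def lvar_pos_inject)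

end

text \<open>
  \<open>F[\<partial>]\<close>; \<open>F[\<lambda>] \<otimes> F[\<partial>] = F[\<lambda>, \<partial>]\<close>; \<open>RW(4,4)\<close> as the free left module over \<open>F[\<partial>]\<close> with
  basis \<open>a\<^sub>1, \<dots>, a\<^sub>8\<close>; and \<open>F[\<lambda>] \<otimes> RW(4,4)\<close> as the free left module over \<open>F[\<lambda>, \<partial>]\<close> with the
  same basis. The left action is \<open>*s\<close>.
\<close>

type_synonym 'k Fdel = "(ix, 'k) spoly"
type_synonym 'k Flamdel = "(lvar, 'k) spoly"
type_synonym 'k RW = "'k Fdel ^ ix"
type_synonym 'k FlamRW = "'k Flamdel ^ ix"

definition gen :: "ix \<Rightarrow> ('v::supervar, 'k::comm_ring_1) spoly ^ ix" where
  "gen i = axis i 1"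

text \<open>The right action, determined by \<open>a\<^sub>i v = (-1)\<^bsup>p(i) p(v)\<^esup> v a\<^sub>i\<close> for variables \<open>v\<close>.\<close>

definition rmult :: "('v::supervar, 'k::comm_ring_1) spoly ^ ix \<Rightarrow> ('v, 'k) spoly \<Rightarrow>
    ('v, 'k) spoly ^ ix" (infixl "*r" 70) where
  "x *r f = (\<chi> i. x $ i * twist (odd_var i) f)"

definition vpart :: "bool \<Rightarrow> ('v::supervar, 'k::comm_ring_1) spoly ^ ix \<Rightarrow> ('v, 'k) spoly ^ ix" where
  "vpart b x = (\<chi> i. hpart (b \<noteq> odd_var i) (x $ i))"

text \<open>Coordinates with respect to the basis of the right module, see \<open>rcoord_expansion\<close>.\<close>

definition rcoord :: "'k::comm_ring_1 RW \<Rightarrow> ix \<Rightarrow> 'k Fdel" where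
  "rcoord y j = twist (odd_var j) (y $ j)"

text \<open>The substitutions \<open>\<partial> \<mapsto> -\<lambda>\<close> and \<open>\<partial> \<mapsto> \<partial> + \<lambda>\<close>, and the embeddings of \<open>F[\<lambda>]\<close>, of
  \<open>F[\<partial>]\<close> and of \<open>RW(4,4)\<close> (as \<open>1 \<otimes> RW(4,4)\<close>).\<close>

definition neg_lam :: "'k::comm_ring_1 Fdel \<Rightarrow> 'k Flamdel" where
  "neg_lam = subst (\<lambda>i. - Var (Lam i))"

definition shift_lam :: "'k::comm_ring_1 Fdel \<Rightarrow> 'k Flamdel" where
  "shift_lam = subst (\<lambda>i. Var (Del i) + Var (Lam i))"

definition lam_poly :: "'k::comm_ring_1 Fdel \<Rightarrow> 'k Flamdel" where
  "lam_poly = subst (\<lambda>i. Var (Lam i))"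

definition del_poly :: "'k::comm_ring_1 Fdel \<Rightarrow> 'k Flamdel" where
  "del_poly = subst (\<lambda>i. Var (Del i))"

definition one_tensor :: "'k::comm_ring_1 RW \<Rightarrow> 'k FlamRW" where
  "one_tensor x = (\<chi> i. del_poly (x $ i))"

definition gen_bracket :: "ix \<Rightarrow> ix \<Rightarrow> 'k::comm_ring_1 FlamRW" where
  "gen_bracket i j = (Var (Del i) + Var (Lam i)) *s gen j + gen i *r Var (Lam j)"

text \<open>The sesquilinear extension
  \<open>[(f(\<partial>) a\<^sub>i)\<^sub>\<lambda> (a\<^sub>j g(\<partial>))] = f(-\<lambda>) [a\<^sub>i\<^sub>\<lambda> a\<^sub>j] g(\<partial> + \<lambda>)\<close>.\<close>

definition RW_bracket :: "'k::comm_ring_1 RW \<Rightarrow> 'k RW \<Rightarrow> 'k FlamRW" where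
  "RW_bracket x y = (\<Sum>i\<in>UNIV. \<Sum>j\<in>UNIV.
     neg_lam (x $ i) *s (gen_bracket i j *r shift_lam (rcoord y j)))"


subsection \<open>Bilinearity and sesquilinearity of the bracket\<close>

lemma supercommuting_neg_lam: "supercommuting (\<lambda>i. - Var (Lam i) :: 'k::comm_ring_1 Flamdel)"
proof -
  have "supercommuting (\<lambda>i. Var (Lam i) :: 'k Flamdel)" by (rule supercommuting_Var) simp
  then show ?thesis unfolding supercommuting_def minus_mult_minus .
qed

lemma supercommuting_shift_lam: "supercommuting (\<lambda>i. Var (Del i) + Var (Lam i) :: 'k::comm_ring_1 Flamdel)"
proof -
  have LL: "Var (Lam v) * Var (Lam w) = (if odd_var v \<and> odd_var w then - (Var (Lam w) * Var (Lam v)) else Var (Lam w) * (Var (Lam v) :: 'k Flamdel))"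
    and LD: "Var (Lam v) * Var (Del w) = (if odd_var v \<and> odd_var w then - (Var (Del w) * Var (Lam v)) else Var (Del w) * (Var (Lam v) :: 'k Flamdel))"
    and DL: "Var (Del v) * Var (Lam w) = (if odd_var v \<and> odd_var w then - (Var (Lam w) * Var (Del v)) else Var (Lam w) * (Var (Del v) :: 'k Flamdel))"
    and DD: "Var (Del v) * Var (Del w) = (if odd_var v \<and> odd_var w then - (Var (Del w) * Var (Del v)) else Var (Del w) * (Var (Del v) :: 'k Flamdel))"
    for v w
    using Var_commute[of "Lam v" "Lam w"] Var_commute[of "Lam v" "Del w"]
      Var_commute[of "Del v" "Lam w"] Var_commute[of "Del v" "Del w"] by simp_all
  show ?thesis
    unfolding supercommuting_def
  proof (intro conjI allI impI)
    fix v w :: ix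
    show "(Var (Del v) + Var (Lam v)) * (Var (Del w) + Var (Lam w)) =
      (if odd_var v \<and> odd_var w then - ((Var (Del w) + Var (Lam w)) * (Var (Del v) + Var (Lam v)))
       else (Var (Del w) + Var (Lam w)) * (Var (Del v) + Var (Lam v) :: 'k Flamdel))"
      unfolding distrib_left distrib_right LL[of v w] LD[of v w] DL[of v w] DD[of v w]
      by (simp add: add_ac)
  next
    fix v :: ix
    assume "odd_var v"
    then show "(Var (Del v) + Var (Lam v)) * (Var (Del v) + Var (Lam v) :: 'k Flamdel) = 0"
      unfolding distrib_left distrib_right DL[of v v] by (simp add: Var_square)
  qed
qed

lemma neg_lam_simps:
  "neg_lam (f + g) = neg_lam f + neg_lam g" "neg_lam (f * g) = neg_lam f * neg_lam g"
  "neg_lam (Var i) = - Var (Lam i)" "neg_lam 0 = 0" "neg_lam 1 = 1"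
  using subst_const[OF supercommuting_neg_lam, of 1]
  by (simp_all add: neg_lam_def subst_add subst_mult[OF supercommuting_neg_lam]
      subst_Var[OF supercommuting_neg_lam])

lemma shift_lam_simps:
  "shift_lam (f + g) = shift_lam f + shift_lam g" "shift_lam (f * g) = shift_lam f * shift_lam g"
  "shift_lam (Var i) = Var (Del i) + Var (Lam i)" "shift_lam 0 = 0" "shift_lam 1 = 1"
  using subst_const[OF supercommuting_shift_lam, of 1]
  by (simp_all add: shift_lam_def subst_add subst_mult[OF supercommuting_shift_lam]
      subst_Var[OF supercommuting_shift_lam])

lemma smult_simps:
  fixes x y :: "('v::supervar, 'k::comm_ring_1) spoly ^ ix"
  shows "(f + g) *s x = f *s x + g *s x" "f *s (x + y) = f *s x + f *s y"
    "(f * g) *s x = f *s (g *s x)" "1 *s x = x" "0 *s x = 0" "f *s 0 = 0" "(- f) *s x = - (f *s x)"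
  by (simp_all add: vec_eq_iff algebra_simps)

lemma rmult_simps:
  fixes x y :: "('v::supervar, 'k::comm_ring_1) spoly ^ ix"
  shows "(x + y) *r f = x *r f + y *r f" "x *r (f + g) = x *r f + x *r g"
    "x *r (f * g) = (x *r f) *r g" "x *r 1 = x" "x *r 0 = 0" "0 *r f = 0" "(f *s x) *r g = f *s (x *r g)"
  by (simp_all add: vec_eq_iff rmult_def distrib_left distrib_right mult.assoc twist_add twist_mult)

lemma rmult_Var:
  assumes "vpart b x = x"
  shows "x *r Var v = (if b \<and> odd_var v then - (Var v *s x) else Var v *s x)"
proof -
  have "x $ i * twist (odd_var i) (Var v) = (if b \<and> odd_var v then - (Var v * x $ i) else Var v * x $ i)" for i
  proof -
    have h: "x $ i = hpart (b \<noteq> odd_var i) (x $ i)"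
      using arg_cong[OF assms, of "\<lambda>y. y $ i"] by (simp add: vpart_def)
    have "twist c (hpart d f) = (if c \<and> d then - hpart d f else hpart d f)"
      for c d and f :: "('a, 'b) spoly"
      by (rule coeff_inject_ext) (auto simp: coeff_twist hpart.rep_eq)
    from this[of "odd_var v" "b \<noteq> odd_var i" "x $ i"]
    have "twist (odd_var v) (x $ i) =
        (if odd_var v \<and> b \<noteq> odd_var i then - (x $ i) else x $ i)" by (simp only: h[symmetric])
    then show ?thesis by (auto simp: twist_Var mult_Var)
  qed
  then show ?thesis by (auto simp add: vec_eq_iff rmult_def)
qed

lemma smult_sum: "f *s (\<Sum>a\<in>A. F a) = (\<Sum>a\<in>A. f *s F a)"
  for F :: "'a \<Rightarrow> ('v::supervar, 'k::comm_ring_1) spoly ^ ix"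
  by (induction A rule: infinite_finite_induct) (simp_all add: smult_simps)

lemma rmult_sum: "(\<Sum>a\<in>A. F a) *r f = (\<Sum>a\<in>A. F a *r f)"
  for F :: "'a \<Rightarrow> ('v::supervar, 'k::comm_ring_1) spoly ^ ix"
  by (induction A rule: infinite_finite_induct) (simp_all add: rmult_simps)

lemma rcoord_expansion: "(\<Sum>j\<in>UNIV. gen j *r rcoord y j) = y"
  by (simp add: vec_eq_iff rmult_def gen_def rcoord_def axis_def if_distrib[of "\<lambda>x. x * _"]
      sum.delta cong: if_cong)

lemma rcoord_rmult: "rcoord (y *r f) j = rcoord y j * f"
  by (simp add: rcoord_def rmult_def twist_mult)

lemma RW_bracket_add_left: "RW_bracket (x + x') y = RW_bracket x y + RW_bracket x' y"
  by (simp add: RW_bracket_def neg_lam_simps smult_simps sum.distrib)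

lemma RW_bracket_add_right: "RW_bracket x (y + y') = RW_bracket x y + RW_bracket x y'"
  by (simp add: RW_bracket_def rcoord_def twist_add shift_lam_simps smult_simps rmult_simps sum.distrib)

lemma RW_bracket_left: "RW_bracket (f *s x) y = neg_lam f *s RW_bracket x y"
  by (simp add: RW_bracket_def neg_lam_simps smult_simps smult_sum)

lemma RW_bracket_right: "RW_bracket x (y *r g) = RW_bracket x y *r shift_lam g"
  by (simp add: RW_bracket_def rcoord_rmult shift_lam_simps rmult_simps rmult_sum)

lemma RW_bracket_sesquilinear:
  "RW_bracket (Var i *s x) y = - (Var (Lam i) *s RW_bracket x y)"
  "RW_bracket x (y *r Var i) = RW_bracket x y *r (Var (Del i) + Var (Lam i))"
  by (simp_all add: RW_bracket_left RW_bracket_right neg_lam_simps shift_lam_simps smult_simps)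

lemma RW_bracket_gen: "RW_bracket (gen i) (gen j) = gen_bracket i j"
proof -
  have "RW_bracket (gen i) (gen j :: 'a RW) =
      (\<Sum>k\<in>UNIV. \<Sum>l\<in>UNIV. if l = j then (if k = i then gen_bracket k l else 0) else 0)"
    unfolding RW_bracket_def
    by (intro sum.cong refl)
      (simp add: gen_def axis_def rcoord_def neg_lam_simps shift_lam_simps smult_simps rmult_simps)
  also have "\<dots> = gen_bracket i j" by (simp add: sum.delta)
  finally show ?thesis .
qed


section \<open>Subalgebras\<close>

text \<open>Submodules of the bimodule \<open>RW(4,4)\<close> are understood in the category of superspaces,
  hence are graded.\<close>

definition RW_submodule :: "'k::comm_ring_1 RW set \<Rightarrow> bool" where
  "RW_submodule S \<longleftrightarrow> 0 \<in> S \<and> (\<forall>x\<in>S. \<forall>y\<in>S. x + y \<in> S) \<and>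
     (\<forall>f. \<forall>x\<in>S. f *s x \<in> S \<and> x *r f \<in> S) \<and> (\<forall>b. \<forall>x\<in>S. vpart b x \<in> S)"

text \<open>\<open>F[\<lambda>] \<otimes> S\<close> as a subset of \<open>F[\<lambda>] \<otimes> RW(4,4)\<close>.\<close>

definition lam_tensor :: "'k::comm_ring_1 RW set \<Rightarrow> 'k FlamRW set" where
  "lam_tensor S = {(\<Sum>k<n. lam_poly (f k) *s one_tensor (s k)) | (n::nat) f s. \<forall>k<n. s k \<in> S}"

definition conformal_subalgebra :: "'k::comm_ring_1 RW set \<Rightarrow> bool" where
  "conformal_subalgebra S \<longleftrightarrow> RW_submodule S \<and> (\<forall>x\<in>S. \<forall>y\<in>S. RW_bracket x y \<in> lam_tensor S)"


section \<open>The elements \<open>\<alpha>\<^sub>i\<close> and \<open>RE(4,4)\<close>\<close>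

text \<open>The variables and the generators, indexed by the natural numbers \<open>1, \<dots>, 8\<close>:
  \<open>\<partial>\<^sub>i\<close> in \<open>F[\<partial>]\<close>, and \<open>\<partial>\<^sub>i\<close> and \<open>\<lambda>\<^sub>i\<close> in \<open>F[\<lambda>, \<partial>]\<close>.\<close>

definition dR :: "nat \<Rightarrow> 'k::comm_ring_1 Fdel" where
  "dR i = Var (Ix i)"

definition dL :: "nat \<Rightarrow> 'k::comm_ring_1 Flamdel" where
  "dL i = Var (Del (Ix i))"

definition lam :: "nat \<Rightarrow> 'k::comm_ring_1 Flamdel" where
  "lam i = Var (Lam (Ix i))"

definition a_gen :: "nat \<Rightarrow> 'k::comm_ring_1 RW" where
  "a_gen i = gen (Ix i)"

text \<open>The forms \<open>B\<close> and \<open>C\<close>; the product \<open>m\<close> is either the multiplication of the algebra or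
  its left action on the module.\<close>

definition Bform :: "('a \<Rightarrow> 'b \<Rightarrow> 'c::comm_monoid_add) \<Rightarrow> (nat \<Rightarrow> 'a) \<Rightarrow> (nat \<Rightarrow> 'b) \<Rightarrow> 'c" where
  "Bform m u v = (\<Sum>i=1..4. m (u i) (v (i + 4)))"

definition Cform :: "('a \<Rightarrow> 'b \<Rightarrow> 'c::comm_monoid_add) \<Rightarrow> (nat \<Rightarrow> 'a) \<Rightarrow> (nat \<Rightarrow> 'b) \<Rightarrow> 'c" where
  "Cform m u v = (\<Sum>i=1..4. m (u i) (v (i + 4)) + m (u (i + 4)) (v i))"

text \<open>This is \<open>\<nu>\<close> for \<open>d = \<partial>\<close> and \<open>\<mu>\<close> for \<open>d = \<lambda>\<close>.\<close>

definition cubic :: "(nat \<Rightarrow> 'a::ring_1) \<Rightarrow> nat \<Rightarrow> 'a" where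
  "cubic d i =
    (if i = 1 then d 6 * d 7 * d 8
     else if i = 2 then - (d 5 * d 7 * d 8)
     else if i = 3 then d 5 * d 6 * d 8
     else if i = 4 then - (d 5 * d 6 * d 7)
     else 0)"

abbreviation nu :: "nat \<Rightarrow> 'k::comm_ring_1 Fdel" where
  "nu \<equiv> cubic dR"

abbreviation mu :: "nat \<Rightarrow> 'k::comm_ring_1 Flamdel" where
  "mu \<equiv> cubic lam"

definition alpha :: "nat \<Rightarrow> 'k::comm_ring_1 RW" where
  "alpha i = (dR i * Bform (*) dR dR) *s Cform (*s) dR a_gen
     - (2 * nu i) *s Cform (*s) dR a_gen
     + dR i *s Bform (*s) nu a_gen"

text \<open>\<open>1 \<otimes> \<alpha>\<^sub>i\<close>\<close>

abbreviation alphaL :: "nat \<Rightarrow> 'k::comm_ring_1 FlamRW" where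
  "alphaL i \<equiv> one_tensor (alpha i)"

definition RE :: "'k::comm_ring_1 RW set" where
  "RE = \<Inter> {S. RW_submodule S \<and> (\<forall>i\<in>{1..8}. alpha i \<in> S)}"

end

theory Submission
  imports Defs
begin

text \<open>
  Write \<open>k'\<close> for the index paired with \<open>k\<close> by the forms \<open>B\<close> and \<open>C\<close>. The coefficient of \<open>a\<^sub>k\<close> in \<open>\<alpha>\<^sub>i\<close> is
  \<open>A\<^sub>i\<^sub>k(\<partial>) = \<partial>\<^sub>i (B\<^bsub>\<partial>\<partial>\<^esub> \<partial>\<^sub>k\<^sub>' + \<nu>\<^sub>k\<^sub>') - 2 \<nu>\<^sub>i \<partial>\<^sub>k\<^sub>'\<close>, a polynomial of degree \<open>4\<close>. Sesquilinearity turns the bracket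
  of two vectors into a formula in their coordinates (\<open>RW_bracket_coord\<close>), the formal analogue of the
  commutator of vector fields. For the \<open>\<alpha>\<^sub>i\<close> it says that the coefficient of \<open>a\<^sub>k\<close> in \<open>[\<alpha>\<^sub>i\<^sub>\<lambda> \<alpha>\<^sub>j]\<close> is
  \<open>(\<Sum>\<^sub>m A\<^sub>i\<^sub>m(\<lambda>) (\<partial>\<^sub>m + \<lambda>\<^sub>m)) A\<^sub>j\<^sub>k(\<partial> + \<lambda>) \<plusminus> A\<^sub>i\<^sub>k(\<lambda>) (\<Sum>\<^sub>m A\<^sub>j\<^sub>m(\<partial> + \<lambda>) \<lambda>\<^sub>m)\<close>.
  So the bracket formula is a finite family of polynomial identities in the sixteen supercommuting
  variables \<open>\<lambda>\<^sub>i\<close>, \<open>\<partial>\<^sub>i\<close>.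

  The first sum is the coefficient of \<open>\<alpha>\<^sub>j\<close> in the asserted formula (\<open>left_defect_zero\<close>). After this
  substitution, what remains depends on \<open>i\<close> only through \<open>\<lambda>\<^sub>i\<close> and \<open>\<mu>\<^sub>i\<close>, with coefficients that have to be
  computed for the \<open>64\<close> pairs \<open>(j, k)\<close> (\<open>main_identity\<close>). These identities are expanded in
  a normal form: polynomials in supercommuting variables are represented by iterated Horner forms,
  whose arithmetic is proved correct (\<open>horner_val_add\<close>, \<open>horner_val_neg\<close>, \<open>horner_val_mult\<close>) and then
  evaluated by rewriting.

  For the subalgebra property, the \<open>\<alpha>\<^sub>i\<close> are homogeneous, so their left linear span is a graded
  subbimodule and equals \<open>RE(4,4)\<close> (\<open>RE_span\<close>). For each submodule \<open>S\<close>, the space \<open>F[\<lambda>] \<otimes> S\<close> is stable under left and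
  right multiplication by \<open>F[\<lambda>, \<partial>]\<close> (\<open>lam_tensor_smult\<close>, \<open>lam_tensor_rmult\<close>). The bracket formula
  puts the brackets of generators into \<open>F[\<lambda>] \<otimes> RE(4,4)\<close>, and sesquilinearity does the rest.
\<close>


section \<open>Generation by the variables, and parities\<close>

text \<open>The monomials are products of variables up to sign, so a property that survives
  left multiplication by a variable holds for all polynomials.\<close>

lemma spoly_induct [case_names const add Var]:
  fixes f :: "('v::supervar, 'k::comm_ring_1) spoly"
  assumes const: "\<And>c. P (const c)"
    and add: "\<And>f g. P f \<Longrightarrow> P g \<Longrightarrow> P (f + g)"
    and Var: "\<And>v f. P f \<Longrightarrow> P (Var v * f)"
  shows "P f"
proof -
  have monom: "P (monom m c)" for m c
  proof (induction "\<Sum>v\<in>UNIV. m v" arbitrary: m c)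
    case 0
    then have "m = (\<lambda>_. 0)" by (simp add: fun_eq_iff)
    with const[of c] show ?case by (simp add: const_def)
  next
    case (Suc n)
    then obtain v where v: "m v \<noteq> 0" by (metis sum.neutral nat.simps(3))
    let ?u = "\<lambda>w. if w = v then 1 else 0 :: nat"
    define p where "p = m(v := m v - 1)"
    have m: "(\<lambda>w. ?u w + p w) = m" using v by (auto simp: p_def fun_eq_iff)
    have "(\<Sum>w\<in>UNIV. m w) = (\<Sum>w\<in>UNIV. ?u w) + (\<Sum>w\<in>UNIV. p w)"
      by (subst m[symmetric]) (simp only: sum.distrib)
    then have "n = (\<Sum>w\<in>UNIV. p w)" using Suc.hyps(2) by simp
    \<comment> \<open>The power of \<open>-1\<close> compensates the sign that sorts \<open>v\<close> into the monomial \<open>p\<close>.\<close>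
    then have "P (Var v * monom p ((-1) ^ swaps ?u p * c))" by (intro Var Suc.hyps(1))
    also have "Var v * monom p ((-1) ^ swaps ?u p * c) = monom m c"
      unfolding Var_def monom_mult m
      by (simp add: mult.assoc[symmetric] power_mult_distrib[symmetric])
    finally show ?case .
  qed
  have zero: "P 0" using const[of 0] by simp
  have "P (\<Sum>m\<in>A. monom m (coeff f m))" for A
    by (induction A rule: infinite_finite_induct) (auto intro: zero add monom)
  then show ?thesis by (subst spoly_decomp)
qed

lemma twist_const [simp]: "twist b (const c) = const c"
  by (rule coeff_inject_ext) (auto simp: coeff_twist const_def coeff_monom odd_deg_def)

lemma twist_sum: "twist b (sum F A) = (\<Sum>a\<in>A. twist b (F a))"
  by (induction A rule: infinite_finite_induct) (simp_all add: twist_add)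

text \<open>A substitution that respects parities preserves the decomposition into even and odd
  parts.\<close>

lemma twist_subst:
  assumes "supercommuting \<phi>"
    and "\<And>v. twist b (\<phi> v) = (if b \<and> odd_var v then - \<phi> v else \<phi> v)"
  shows "twist b (subst \<phi> f) = subst \<phi> (twist b f)"
  by (induction f rule: spoly_induct)
    (simp_all add: subst_const[OF assms(1)] twist_add subst_add subst_mult[OF assms(1)]
      subst_Var[OF assms(1)] twist_mult twist_Var subst_uminus assms(2))

lemma hpart_add: "hpart b (f + g) = hpart b f + hpart b g"
  by (rule coeff_inject_ext) (simp add: hpart.rep_eq)

lemma hpart_uminus: "hpart b (- f) = - hpart b f"
  by (rule coeff_inject_ext) (simp add: hpart.rep_eq)

lemma hpart_0 [simp]: "hpart b 0 = 0"
  by (rule coeff_inject_ext) (simp add: hpart.rep_eq)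

lemma hpart_sum: "hpart b (sum F A) = (\<Sum>a\<in>A. hpart b (F a))"
  by (induction A rule: infinite_finite_induct) (simp_all add: hpart_add)

lemma hpart_monom: "hpart b (monom p c) = (if odd (odd_deg p) = b then monom p c else 0)"
  by (rule coeff_inject_ext) (auto simp: hpart.rep_eq coeff_monom)

lemma hpart_monom_mult:
  "hpart b (monom p c * f) = monom p c * hpart (b \<noteq> odd (odd_deg p)) f"
  by (subst (1 2) spoly_decomp[of f])
    (auto simp: sum_distrib_left hpart_sum monom_mult hpart_monom odd_deg_add intro!: sum.cong)

lemma hpart_const_mult: "hpart b (const c * f) = const c * hpart b f"
  by (simp add: const_def hpart_monom_mult odd_deg_def)

lemma hpart_Var_mult: "hpart b (Var v * f) = Var v * hpart (b \<noteq> odd_var v) f"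
proof -
  have "odd_deg (\<lambda>w. if w = v then 1 else 0) = (if odd_var v then 1 else 0)"
    unfolding odd_deg_def by (subst sum.delta) auto
  then show ?thesis unfolding Var_def hpart_monom_mult by simp
qed

text \<open>Products with a homogeneous factor; the induction on the other factor reduces this to
  multiplication by one variable.\<close>

lemma hpart_mult:
  assumes "hpart c g = g"
  shows "hpart b (f * g) = hpart (b \<noteq> c) f * g"
proof (induction f arbitrary: b rule: spoly_induct)
  case (const a)
  have 1: "hpart b (const a) = (if b then 0 else const a)" for b
    by (simp add: const_def hpart_monom odd_deg_def)
  have "hpart b (hpart c g) = (if b = c then hpart c g else 0)" for b
    by (rule coeff_inject_ext) (auto simp: hpart.rep_eq)
  then have 2: "hpart b g = (if b = c then g else 0)" for b by (simp only: assms)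
  show ?case by (simp add: hpart_const_mult 1 2)
next
  case (Var v f)
  have "((b \<noteq> odd_var v) \<noteq> c) = ((b \<noteq> c) \<noteq> odd_var v)" by auto
  with Var show ?case by (simp add: mult.assoc hpart_Var_mult del: not_iff)
qed (simp add: hpart_add distrib_right)

definition homogeneous :: "bool \<Rightarrow> ('v::supervar, 'k::comm_ring_1) spoly \<Rightarrow> bool" where
  "homogeneous b f \<longleftrightarrow> hpart b f = f"

lemma homogeneous_0: "homogeneous b 0"
  by (simp add: homogeneous_def)

lemma homogeneous_Var: "homogeneous (odd_var v) (Var v)"
proof -
  have "hpart False (const 1) = (const 1 :: ('a, 'b) spoly)"
    by (simp add: const_def hpart_monom odd_deg_def)
  then show ?thesis using hpart_Var_mult[of "odd_var v" v "1 :: ('a, 'b) spoly"]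
    by (simp add: homogeneous_def)
qed

lemma homogeneous_add: "homogeneous b f \<Longrightarrow> homogeneous b g \<Longrightarrow> homogeneous b (f + g)"
  by (simp add: homogeneous_def hpart_add)

lemma homogeneous_uminus: "homogeneous b f \<Longrightarrow> homogeneous b (- f)"
  by (simp add: homogeneous_def hpart_uminus)

lemma homogeneous_diff: "homogeneous b f \<Longrightarrow> homogeneous b g \<Longrightarrow> homogeneous b (f - g)"
  using homogeneous_add[of b f "- g"] homogeneous_uminus[of b g] by simp

lemma homogeneous_sum: "(\<And>a. a \<in> A \<Longrightarrow> homogeneous b (F a)) \<Longrightarrow> homogeneous b (sum F A)"
  by (simp add: homogeneous_def hpart_sum)

lemma homogeneous_mult:
  "homogeneous b f \<Longrightarrow> homogeneous c g \<Longrightarrow> d = (b \<noteq> c) \<Longrightarrow> homogeneous d (f * g)"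
  unfolding homogeneous_def by (subst hpart_mult) (auto simp: not_iff)

lemma twist_homogeneous: "homogeneous c f \<Longrightarrow> twist b f = (if b \<and> c then - f else f)"
proof -
  have "twist b (hpart c f) = (if b \<and> c then - hpart c f else hpart c f)"
    by (rule coeff_inject_ext) (auto simp: coeff_twist hpart.rep_eq)
  then show "homogeneous c f \<Longrightarrow> twist b f = (if b \<and> c then - f else f)"
    by (simp only: homogeneous_def)
qed

lemma rmult_const: "x *r const c = const c *s x"
  by (simp add: vec_eq_iff rmult_def const_commute)

text \<open>Supercommutativity of the ring, seen on the bimodule: a homogeneous vector can be moved
  past any scalar.\<close>

lemma rmult_homogeneous: "vpart b x = x \<Longrightarrow> x *r f = twist b f *s x"
proof (induction f rule: spoly_induct)
  case (Var v f)
  have "x *r (Var v * f) = (x *r Var v) *r f" by (rule rmult_simps)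
  also have "\<dots> = twist b (Var v) *s (x *r f)"
    unfolding rmult_Var[OF Var.prems] twist_Var
    by (auto simp: smult_simps(7)[symmetric] rmult_simps(7) simp del: smult_simps(7) vector_smult_lneg)
  finally show ?case using Var by (simp add: smult_simps twist_mult)
qed (simp_all add: rmult_const rmult_simps smult_simps twist_add)


section \<open>Horner forms\<close>

text \<open>Identities between concrete elements of \<open>F[\<lambda>, \<partial>]\<close> are decided by computing with iterated Horner
  forms. Relative to a list of variables with first element \<open>v\<close>, the form \<open>Step p q\<close> stands for
  \<open>p + v q\<close>. Here \<open>p\<close> uses the remaining variables only; so does \<open>q\<close> if \<open>v\<close> is odd, because
  \<open>v\<^sup>2 = 0\<close>, while for even \<open>v\<close> the form \<open>q\<close> is again a polynomial in \<open>v\<close>. A form that outlives the list of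
  variables is read with all further variables equal to \<open>0\<close>. No monomials are ever
  sorted or compared, which keeps the evaluation by rewriting fast.\<close>

datatype horner = Const int | Step horner horner

function horner_val :: "'v::supervar list \<Rightarrow> horner \<Rightarrow> ('v, 'k::comm_ring_1) spoly" where
  "horner_val vs (Const a) = of_int a"
| "horner_val [] (Step p q) = horner_val [] p"
| "horner_val (v # vs) (Step p q) =
    horner_val vs p + Var v * horner_val (if odd_var v then vs else v # vs) q"
  by pat_completeness auto
termination by (relation "measure (size \<circ> snd)") auto

text \<open>A zero tail is dropped only behind a constant: a form depends on the position of the variable
  that it starts with, and in \<open>Step p (Const 0)\<close> the constructor \<open>Step\<close> moves \<open>p\<close> to the next variable.\<close>

fun step :: "horner \<Rightarrow> horner \<Rightarrow> horner" where
  "step (Const a) (Const b) = (if b = 0 then Const a else Step (Const a) (Const b))"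
| "step (Step p q) r = Step (Step p q) r"
| "step (Const a) (Step q r) = Step (Const a) (Step q r)"

fun horner_add :: "horner \<Rightarrow> horner \<Rightarrow> horner" where
  "horner_add (Const a) (Const b) = Const (a + b)"
| "horner_add (Const a) (Step p q) = Step (horner_add (Const a) p) q"
| "horner_add (Step p q) (Const a) = Step (horner_add p (Const a)) q"
| "horner_add (Step p q) (Step r s) = step (horner_add p r) (horner_add q s)"

fun horner_scale :: "int \<Rightarrow> horner \<Rightarrow> horner" where
  "horner_scale a (Const b) = Const (a * b)"
| "horner_scale a (Step p q) = Step (horner_scale a p) (horner_scale a q)"

fun horner_neg :: "horner \<Rightarrow> horner" where
  "horner_neg (Const b) = Const (- b)"
| "horner_neg (Step p q) = Step (horner_neg p) (horner_neg q)"

text \<open>The boolean lists give the parities of the variables (\<open>True\<close> for odd). This is the sign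
  change produced by moving an odd variable past a form.\<close>

fun horner_twist :: "bool list \<Rightarrow> horner \<Rightarrow> horner" where
  "horner_twist bs (Const a) = Const a"
| "horner_twist [] (Step p q) = Step p q"
| "horner_twist (True # bs) (Step p q) = Step (horner_twist bs p) (horner_neg (horner_twist bs q))"
| "horner_twist (False # bs) (Step p q) = Step (horner_twist bs p) (horner_twist (False # bs) q)"

text \<open>Multiplication by a coefficient \<open>a\<close> free of the first variable \<open>v\<close>, where \<open>f\<close> multiplies by \<open>a\<close> the
  forms in the remaining variables.\<close>

fun map_coeffs :: "(horner \<Rightarrow> horner) \<Rightarrow> horner \<Rightarrow> horner" where
  "map_coeffs f (Const a) = step (f (Const a)) (Const 0)"
| "map_coeffs f (Step p q) = step (f p) (map_coeffs f q)"

text \<open>For odd \<open>v\<close>, one has \<open>(p + v q) (r + v s) = p r + v (q r + p' s)\<close> with \<open>p'\<close> the twist of \<open>p\<close>. For even \<open>v\<close>,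
  \<open>p\<close> multiplies the coefficients of the second factor, and \<open>v q\<close> is dealt with by recursion.\<close>

fun horner_mult :: "bool list \<Rightarrow> horner \<Rightarrow> horner \<Rightarrow> horner" where
  "horner_mult bs (Const a) q =
    (if a = 0 then Const 0 else if a = 1 then q else horner_scale a q)"
| "horner_mult bs (Step p q) (Const b) =
    (if b = 0 then Const 0 else if b = 1 then Step p q else horner_scale b (Step p q))"
| "horner_mult [] (Step p q) (Step r s) = horner_mult [] p r"
| "horner_mult (True # bs) (Step p q) (Step r s) =
    step (horner_mult bs p r) (horner_add (horner_mult bs q r) (horner_mult bs (horner_twist bs p) s))"
| "horner_mult (False # bs) (Step p q) (Step r s) =
    horner_add (map_coeffs (horner_mult bs p) (Step r s))
      (step (Const 0) (horner_mult (False # bs) q (Step r s)))"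

fun horner_zero :: "horner \<Rightarrow> bool" where
  "horner_zero (Const a) \<longleftrightarrow> a = 0"
| "horner_zero (Step p q) \<longleftrightarrow> horner_zero p \<and> horner_zero q"

primrec horner_var :: "nat \<Rightarrow> horner" where
  "horner_var 0 = Step (Const 0) (Const 1)"
| "horner_var (Suc n) = Step (horner_var n) (Const 0)"

lemma of_int_spoly: "(of_int a :: ('v::supervar, 'k::comm_ring_1) spoly) = const (of_int a)"
proof -
  have "(of_nat n :: ('v, 'k) spoly) = const (of_nat n)" for n
    by (induction n) (simp_all add: const_add)
  then show ?thesis by (cases a rule: int_cases2) (simp_all add: const_uminus)
qed

lemma of_int_spoly_commute: "of_int a * f = f * (of_int a :: ('v::supervar, 'k::comm_ring_1) spoly)"
  by (simp add: of_int_spoly const_commute)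

lemma horner_val_step:
  "horner_val (v # vs) (step p q) = horner_val (v # vs) (Step p q)"
  "horner_val [] (step p q) = horner_val [] p"
  by (induction p q rule: step.induct) auto

lemma horner_val_add: "horner_val vs (horner_add p q) = horner_val vs p + horner_val vs q"
proof (induction p q arbitrary: vs rule: horner_add.induct)
  case (2 a p q)
  then show ?case by (cases vs) (auto simp: add_ac)
next
  case (3 p q a)
  then show ?case by (cases vs) (auto simp: add_ac)
next
  case (4 p q r s)
  then show ?case by (cases vs) (auto simp: horner_val_step distrib_left add_ac)
qed simp

lemma horner_val_neg: "horner_val vs (horner_neg p) = - horner_val vs p"
proof (induction p arbitrary: vs)
  case (Step p q)
  then show ?case by (cases vs) auto
qed simp

lemma horner_val_scale: "horner_val vs (horner_scale a p) = of_int a * horner_val vs p"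
proof (induction p arbitrary: vs)
  case (Step p q)
  have "of_int a * (Var v * f) = Var v * (of_int a * f)" for v and f :: "('a, 'b) spoly"
    by (metis of_int_spoly_commute mult.assoc)
  with Step show ?case by (cases vs) (auto simp: distrib_left)
qed simp

lemma horner_val_twist:
  "horner_val vs (horner_twist (map odd_var vs) p) = twist True (horner_val vs p)"
proof (induction p arbitrary: vs)
  case (Const a)
  then show ?case by (simp add: of_int_spoly)
next
  case (Step p q)
  show ?case
  proof (cases vs)
    case Nil
    then show ?thesis using Step.IH(1)[of "[]"]
      by (cases p) (simp_all add: of_int_spoly)
  next
    case (Cons v vs')
    then show ?thesis using Step.IH(1)[of vs'] Step.IH(2)[of "if odd_var v then vs' else vs"]
      by (cases "odd_var v") (auto simp: twist_add twist_mult twist_Var horner_val_neg)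
  qed
qed

lemma horner_val_map_coeffs:
  assumes "\<not> odd_var v" and f: "\<And>r. horner_val vs (f r) = a * horner_val vs r"
  shows "horner_val (v # vs) (map_coeffs f q) = a * horner_val (v # vs) q"
proof (induction q)
  case (Step r s)
  have "a * (Var v * g) = Var v * (a * g)" for g
    using assms(1) mult_Var[of a v] by (simp add: mult.assoc[symmetric])
  with Step show ?case using assms by (simp add: horner_val_step distrib_left)
qed (use assms in \<open>simp add: horner_val_step\<close>)

lemma horner_val_mult:
  "horner_val vs (horner_mult (map odd_var vs) p q) = horner_val vs p * horner_val vs q"
proof (induction "map odd_var vs" p q arbitrary: vs rule: horner_mult.induct)
  case (1 a q)
  then show ?case by (simp add: horner_val_scale)
next
  case (2 p q b)
  then show ?case by (simp add: horner_val_scale of_int_spoly_commute del: horner_scale.simps)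
next
  case (3 p q r s)
  then show ?case by simp
next
  case (4 bs p q r s)
  then obtain v vs' where vs: "vs = v # vs'" "odd_var v" "bs = map odd_var vs'" by auto
  have "Var v * f * (Var v * g) = 0" for f g :: "('a, 'b) spoly"
  proof -
    have "Var v * f * (Var v * g) = Var v * (f * Var v) * g" by (simp add: mult.assoc)
    also have "\<dots> = (Var v * Var v) * (twist (odd_var v) f * g)" by (simp only: mult_Var[of f v] mult.assoc)
    finally show ?thesis by (simp add: Var_square vs)
  qed
  moreover have "f * (Var v * g) = Var v * (twist True f * g)" for f g :: "('a, 'b) spoly"
    using mult_Var[of f v] vs by (simp add: mult.assoc[symmetric])
  ultimately have "(f + Var v * g) * (f' + Var v * g') = f * f' + Var v * (g * f' + twist True f * g')"
    for f g f' g' :: "('a, 'b) spoly"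
    unfolding distrib_left distrib_right by (simp add: mult.assoc add_ac)
  then show ?case
    using 4(1)[OF vs(3)] 4(2)[OF vs(3)] 4(3)[OF vs(3)]
    by (simp add: vs horner_val_step horner_val_add horner_val_twist)
next
  case (5 bs p q r s)
  then obtain v vs' where vs: "vs = v # vs'" "\<not> odd_var v" "bs = map odd_var vs'" by auto
  have "(horner_val vs (map_coeffs (horner_mult bs p) (Step r s)) :: ('a, 'b) spoly) =
      horner_val vs' p * horner_val vs (Step r s)"
    unfolding vs(1) using vs(2) 5(1)[OF vs(3)] by (intro horner_val_map_coeffs) (auto simp: vs(3))
  then show ?case using 5(2)[of vs] vs
    by (simp add: horner_val_step horner_val_add distrib_right mult.assoc del: horner_val.simps(3) map_coeffs.simps)
       (simp add: mult.assoc distrib_right)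
qed

lemma horner_val_zero: "horner_zero p \<Longrightarrow> horner_val vs p = 0"
proof (induction p arbitrary: vs)
  case (Step p q)
  then show ?case by (cases vs) auto
qed simp

lemma horner_val_var:
  "n < length vs \<Longrightarrow> horner_val vs (horner_var n) = (Var (vs ! n) :: ('v::supervar, 'k::comm_ring_1) spoly)"
proof (induction n arbitrary: vs)
  case 0
  then show ?case by (cases vs) auto
next
  case (Suc n)
  then show ?case by (cases vs) auto
qed


section \<open>The identity between the coordinates\<close>

text \<open>The following expressions require the arithmetic operations, but no laws. They can
  therefore be evaluated both in the ring \<open>F[\<lambda>, \<partial>]\<close>, where they have their mathematical meaning, and
  on Horner forms, where they are computed. The arguments \<open>l\<close> and \<open>d\<close> stand for \<open>\<lambda>\<close> and \<open>\<partial>\<close>.\<close>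

definition dual :: "nat \<Rightarrow> nat" where
  "dual i = (if i \<le> 4 then i + 4 else i - 4)"

definition pairB :: "(nat \<Rightarrow> 'a::{plus, times}) \<Rightarrow> (nat \<Rightarrow> 'a) \<Rightarrow> 'a" where
  "pairB u v = u 1 * v 5 + u 2 * v 6 + u 3 * v 7 + u 4 * v 8"

definition pairC :: "(nat \<Rightarrow> 'a::{plus, times}) \<Rightarrow> (nat \<Rightarrow> 'a) \<Rightarrow> 'a" where
  "pairC u v = pairB u v + pairB (\<lambda>i. u (dual i)) (\<lambda>i. v (dual i))"

text \<open>The analogue of \<^const>\<open>cubic\<close> for types without ring laws.\<close>

definition cubics :: "(nat \<Rightarrow> 'a::{zero, uminus, times}) \<Rightarrow> nat \<Rightarrow> 'a" where
  "cubics d i =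
    (if i = 1 then d 6 * d 7 * d 8
     else if i = 2 then - (d 5 * d 7 * d 8)
     else if i = 3 then d 5 * d 6 * d 8
     else if i = 4 then - (d 5 * d 6 * d 7)
     else 0)"

definition twice :: "'a::plus \<Rightarrow> 'a" where
  "twice x = x + x"

definition thrice :: "'a::plus \<Rightarrow> 'a" where
  "thrice x = x + x + x"

definition signed :: "bool \<Rightarrow> 'a::uminus \<Rightarrow> 'a" where
  "signed b x = (if b then - x else x)"

definition contraction :: "(nat \<Rightarrow> 'a::{plus, times}) \<Rightarrow> (nat \<Rightarrow> 'a) \<Rightarrow> 'a" where
  "contraction u v = pairB u (\<lambda>i. v (dual i)) + pairB (\<lambda>i. u (dual i)) v"

text \<open>Collecting the coefficient of \<open>a\<^sub>k\<close> in \<open>\<alpha>\<^sub>i\<close>, and writing \<open>k'\<close> for the dual index of \<open>k\<close>, gives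
  \<open>\<partial>\<^sub>i (B \<partial>\<^sub>k\<^sub>' + \<nu>\<^sub>k\<^sub>') - 2 \<nu>\<^sub>i \<partial>\<^sub>k\<^sub>'\<close>.\<close>

definition alpha_tail :: "(nat \<Rightarrow> 'a::{zero, plus, uminus, times}) \<Rightarrow> nat \<Rightarrow> 'a" where
  "alpha_tail d k = pairB d d * d (dual k) + cubics d (dual k)"

definition alpha_coord :: "(nat \<Rightarrow> 'a::{zero, plus, minus, uminus, times}) \<Rightarrow> nat \<Rightarrow> nat \<Rightarrow> 'a" where
  "alpha_coord d i k = d i * alpha_tail d k - twice (cubics d i * d (dual k))"

text \<open>The coefficient of \<open>\<alpha>\<^sub>j\<close> in the asserted formula for the bracket.\<close>

definition left_factor :: "(nat \<Rightarrow> 'a::{zero, plus, minus, uminus, times}) \<Rightarrow> (nat \<Rightarrow> 'a) \<Rightarrow> nat \<Rightarrow> 'a" where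
  "left_factor l d i = l i * pairC (cubics l) d + l i * pairB l l * pairC l d - twice (cubics l i * pairC l d)"

text \<open>The vector field attached to \<open>\<alpha>\<^sub>i\<close>, paired with \<open>\<partial> + \<lambda>\<close>, is this coefficient: the terms without \<open>\<partial>\<close>
  add up to \<open>\<lambda>\<^sub>i (2 B\<^sup>2 + B\<^bsub>\<mu>\<lambda>\<^esub>) - 4 \<mu>\<^sub>i B\<close> with \<open>B = B\<^bsub>\<lambda>\<lambda>\<^esub>\<close> odd. So \<open>B\<^sup>2 = 0\<close>, and with
  \<open>\<Omega> = \<lambda>\<^sub>5 \<lambda>\<^sub>6 \<lambda>\<^sub>7 \<lambda>\<^sub>8\<close> one has \<open>B\<^bsub>\<mu>\<lambda>\<^esub> = - 4 \<Omega>\<close> and \<open>\<mu>\<^sub>i B = - \<lambda>\<^sub>i \<Omega>\<close>, and everything cancels.\<close>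

definition left_defect :: "(nat \<Rightarrow> 'a::{zero, plus, minus, uminus, times}) \<Rightarrow> (nat \<Rightarrow> 'a) \<Rightarrow> nat \<Rightarrow> 'a" where
  "left_defect l d i = contraction (alpha_coord l i) (\<lambda>m. d m + l m) - left_factor l d i"

definition increment :: "(nat \<Rightarrow> 'a::{zero, plus, minus, uminus, times}) \<Rightarrow> (nat \<Rightarrow> 'a) \<Rightarrow> nat \<Rightarrow> nat \<Rightarrow> 'a" where
  "increment l d j k = alpha_coord (\<lambda>m. d m + l m) j k - alpha_coord d j k"

text \<open>The sign comes from moving a polynomial of the parity of \<open>\<alpha>\<^sub>j\<close> past \<open>a\<^sub>k\<close>.\<close>

definition right_factor :: "(nat \<Rightarrow> 'a::{zero, plus, minus, uminus, times}) \<Rightarrow> (nat \<Rightarrow> 'a) \<Rightarrow> nat \<Rightarrow> nat \<Rightarrow> 'a" where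
  "right_factor l d j k =
    signed (5 \<le> j \<and> 5 \<le> k) (contraction (alpha_coord (\<lambda>m. d m + l m) j) l)"

text \<open>The coefficients of \<open>a\<^sub>k\<close> in \<open>C\<^bsub>\<lambda>\<alpha>\<^esub>\<close> and in \<open>B\<^bsub>\<mu>\<alpha>\<^esub>\<close>.\<close>

definition mixC :: "(nat \<Rightarrow> 'a::{zero, plus, minus, uminus, times}) \<Rightarrow> (nat \<Rightarrow> 'a) \<Rightarrow> nat \<Rightarrow> 'a" where
  "mixC l d k = pairC l (\<lambda>m. alpha_coord d m k)"

definition mixB :: "(nat \<Rightarrow> 'a::{zero, plus, minus, uminus, times}) \<Rightarrow> (nat \<Rightarrow> 'a) \<Rightarrow> nat \<Rightarrow> 'a" where
  "mixB l d k = pairB (cubics l) (\<lambda>m. alpha_coord d m k)"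

text \<open>Both sides of the asserted formula depend on \<open>i\<close> only through \<open>\<lambda>\<^sub>i\<close> and \<open>\<mu>\<^sub>i\<close>. Their difference is
  \<open>\<lambda>\<^sub>i H - 2 \<mu>\<^sub>i G + 2 \<lambda>\<^sub>j \<mu>\<^sub>i Q\<close>, where \<open>H\<close>, \<open>G\<close> and \<open>Q\<close> are
  \<open>linear_part\<close>, \<open>cubic_part\<close> and \<open>mixC\<close>. In general \<open>H\<close> and \<open>G\<close> do not vanish, only the combination does;
  but they are computed once for all eight values of \<open>i\<close>.\<close>

definition linear_part :: "(nat \<Rightarrow> 'a::{zero, plus, minus, uminus, times}) \<Rightarrow> (nat \<Rightarrow> 'a) \<Rightarrow> nat \<Rightarrow> nat \<Rightarrow> 'a" where
  "linear_part l d j k =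
    (pairC (cubics l) d + pairB l l * pairC l d) * increment l d j k + alpha_tail l k * right_factor l d j k
    - (l j * pairB l l - twice (cubics l j)) * mixC l d k - thrice (l j * mixB l d k)"

definition cubic_part :: "(nat \<Rightarrow> 'a::{zero, plus, minus, uminus, times}) \<Rightarrow> (nat \<Rightarrow> 'a) \<Rightarrow> nat \<Rightarrow> nat \<Rightarrow> 'a" where
  "cubic_part l d j k = pairC l d * increment l d j k + l (dual k) * right_factor l d j k"

text \<open>The parities belong to the variables in the order \<open>\<lambda>\<^sub>5, \<partial>\<^sub>5, \<lambda>\<^sub>1, \<partial>\<^sub>1, \<lambda>\<^sub>6, \<partial>\<^sub>6, \<lambda>\<^sub>2, \<partial>\<^sub>2, \<dots>\<close>. Since the forms
  \<open>B\<close> and \<open>C\<close> pair the index \<open>i\<close> with \<open>i + 4\<close>, this order keeps the Horner forms small.\<close>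

instantiation horner :: "{zero, plus, uminus, minus, times}"
begin
definition "0 = Const 0"
definition "p + q = horner_add p q"
definition "- p = horner_neg p"
definition "p - q = horner_add p (horner_neg q)"
definition "p * q = horner_mult [True, True, False, False, True, True, False, False,
  True, True, False, False, True, True, False, False] p q"
instance ..
end

text \<open>In this order, counted from \<open>0\<close>, the four variables with indices \<open>a\<close> and \<open>a + 4\<close> occupy the positions
  from \<open>4 a - 4\<close> to \<open>4 a - 1\<close>, the odd ones first.\<close>

definition horner_lam :: "nat \<Rightarrow> horner" where
  "horner_lam i = horner_var (if i \<le> 4 then 4 * i - 2 else 4 * i - 20)"

definition horner_del :: "nat \<Rightarrow> horner" where
  "horner_del i = horner_var (if i \<le> 4 then 4 * i - 1 else 4 * i - 19)"

definition left_check :: "nat \<Rightarrow> bool" where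
  "left_check i = horner_zero (left_defect horner_lam horner_del i)"

definition main_check :: "nat \<Rightarrow> nat \<Rightarrow> bool" where
  "main_check j k =
    (let H = linear_part horner_lam horner_del j k; G = twice (cubic_part horner_lam horner_del j k);
       Q = twice (mixC horner_lam horner_del k)
     in list_all (\<lambda>i. horner_zero (horner_lam i * H - cubics horner_lam i * G + horner_lam j * cubics horner_lam i * Q)) [1..<9])"

lemma main_checks_even: "list_all (\<lambda>j. list_all (main_check j) [1..<9]) [1..<5]"
  by code_simp

lemma main_checks_odd: "list_all (\<lambda>j. list_all (main_check j) [1..<9]) [5..<9]"
  by code_simp

lemma main_checks:
  assumes "j \<in> {1..8}" "k \<in> {1..8}"
  shows "main_check j k"
proof -
  have "j \<in> set [1..<5] \<or> j \<in> set [5..<9]" "k \<in> set [1..<9]" using assms by auto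
  then show ?thesis using main_checks_even main_checks_odd unfolding list_all_iff by blast
qed

lemma left_checks: "list_all left_check [1..<9]"
  by code_simp


section \<open>The bracket in coordinates\<close>

lemma twist_shift_lam: "twist b (shift_lam f) = shift_lam (twist b f)"
  unfolding shift_lam_def
  by (rule twist_subst[OF supercommuting_shift_lam]) (simp add: twist_add twist_Var)

text \<open>Since \<open>y = \<Sum>\<^sub>j a\<^sub>j y\<^sub>j\<close> for the right coordinates, the summands \<open>(\<partial>\<^sub>i + \<lambda>\<^sub>i) a\<^sub>j\<close> of the brackets of generators
  reassemble \<open>y(\<partial> + \<lambda>)\<close>, and the summands \<open>a\<^sub>i \<lambda>\<^sub>j\<close> reassemble \<open>x(- \<lambda>)\<close>.\<close>

lemma RW_bracket_coord:
  "RW_bracket x y $ k =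
    (\<Sum>i\<in>UNIV. neg_lam (x $ i) * (Var (Del i) + Var (Lam i))) * shift_lam (y $ k)
    + neg_lam (x $ k) * twist (odd_var k) (\<Sum>j\<in>UNIV. shift_lam (y $ j) * Var (Lam j))"
proof -
  have "RW_bracket x y $ k = (\<Sum>i\<in>UNIV. \<Sum>j\<in>UNIV. neg_lam (x $ i) *
      ((if k = j then Var (Del i) + Var (Lam i) else 0) +
       (if k = i then twist (odd_var i) (Var (Lam j)) else 0)) *
      twist (odd_var k) (shift_lam (rcoord y j)))"
    by (auto simp: RW_bracket_def gen_bracket_def gen_def rmult_def axis_def rcoord_def mult.assoc
        intro!: sum.cong)
  also have "\<dots> = (\<Sum>i\<in>UNIV. neg_lam (x $ i) * (Var (Del i) + Var (Lam i)) *
        twist (odd_var k) (shift_lam (rcoord y k)))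
      + (\<Sum>j\<in>UNIV. neg_lam (x $ k) * (twist (odd_var k) (Var (Lam j)) *
        twist (odd_var k) (shift_lam (rcoord y j))))"
    by (simp add: distrib_left distrib_right sum.distrib if_distrib[of "\<lambda>x. _ * x"]
        if_distrib[of "\<lambda>x. x * _"] mult.assoc cong: if_cong, subst sum.swap, simp)
  also have "(\<Sum>j\<in>UNIV. neg_lam (x $ k) * (twist (odd_var k) (Var (Lam j)) *
        twist (odd_var k) (shift_lam (rcoord y j)))) =
      neg_lam (x $ k) * twist (odd_var k) (\<Sum>j\<in>UNIV. shift_lam (y $ j) * Var (Lam j))"
    by (simp add: twist_sum sum_distrib_left rcoord_def mult_Var twist_mult twist_shift_lam)
  finally show ?thesis
    by (simp add: rcoord_def twist_shift_lam sum_distrib_right)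
qed

lemma UNIV_ix: "(UNIV :: ix set) = Ix ` {1..8}"
  by (metis UNIV_eq_I idx idx_inverse image_eqI)

lemma inj_Ix: "inj_on Ix {1..8}"
  by (auto simp: inj_on_def Ix_inject)

lemma odd_Ix: "i \<in> {1..8} \<Longrightarrow> odd_var (Ix i) \<longleftrightarrow> 5 \<le> i"
  by (simp add: odd_var_ix_def Ix_inverse)

lemma interval_8: "{1..8} = {1, 2, 3, 4, 5, 6, 7, 8 :: nat}"
  by auto

lemma sum_ix: "(\<Sum>i\<in>UNIV. f i) = (\<Sum>n=1..8. f (Ix n))"
  unfolding UNIV_ix sum.reindex[OF inj_Ix] by simp

lemma contraction_eq_sum: "contraction u v = (\<Sum>n=1..8. u n * v n)"
  for u v :: "nat \<Rightarrow> 'a::ring_1"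
  unfolding interval_8 by (simp add: contraction_def pairB_def dual_def add_ac)

lemma Bform_expand: "Bform m u v = m (u 1) (v 5) + m (u 2) (v 6) + m (u 3) (v 7) + m (u 4) (v 8)"
proof -
  have "{1..4} = {1, 2, 3, 4 :: nat}" by auto
  then show ?thesis by (simp add: Bform_def add_ac)
qed

lemma Cform_expand: "Cform m u v = Bform m u v + Bform m (\<lambda>i. u (dual i)) (\<lambda>i. v (dual i))"
proof -
  have "{1..4} = {1, 2, 3, 4 :: nat}" by auto
  then show ?thesis by (simp add: Cform_def Bform_expand dual_def add_ac)
qed

lemma pairB_eq: "pairB u v = Bform (*) u v" for u v :: "nat \<Rightarrow> 'a::ring_1"
  by (simp add: Bform_expand pairB_def)

lemma pairC_eq: "pairC u v = Cform (*) u v" for u v :: "nat \<Rightarrow> 'a::ring_1"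
  by (simp add: Cform_expand pairC_def pairB_eq)

lemma cubics_eq: "cubics d = cubic d" for d :: "nat \<Rightarrow> 'a::ring_1"
  by (simp add: fun_eq_iff cubic_def cubics_def)

lemma twice_eq: "twice x = 2 * x" for x :: "'a::ring_1"
  by (simp add: twice_def mult_2)

lemma thrice_eq: "thrice x = 3 * x" for x :: "'a::ring_1"
proof -
  have "(3 :: 'a) = 1 + 1 + 1" by simp
  then show ?thesis unfolding thrice_def by (simp only: distrib_right mult_1_left)
qed

lemma Bform_smult_coord: "Bform (*s) u w $ n = Bform (*) u (\<lambda>i. w i $ n)"
  by (simp add: Bform_expand)

lemma Cform_smult_coord: "Cform (*s) u w $ n = Cform (*) u (\<lambda>i. w i $ n)"
  by (simp add: Cform_expand Bform_smult_coord)

lemma a_gen_coord: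
  "i \<in> {1..8} \<Longrightarrow> k \<in> {1..8} \<Longrightarrow> a_gen i $ Ix k = (if i = k then 1 else 0)"
  by (auto simp: a_gen_def gen_def axis_def Ix_inject)

lemma alpha_nth:
  assumes "k \<in> {1..8}"
  shows "alpha i $ Ix k = alpha_coord dR i k"
proof -
  have C: "Cform (*) dR (\<lambda>i. a_gen i $ Ix k) = dR (dual k)"
    and B: "Bform (*) nu (\<lambda>i. a_gen i $ Ix k) = nu (dual k)"
    using assms unfolding interval_8
    by (auto simp: Cform_expand Bform_expand dual_def a_gen_coord cubic_def)
  show ?thesis
    by (simp add: alpha_def alpha_coord_def alpha_tail_def Cform_smult_coord Bform_smult_coord B C
        pairB_eq cubics_eq twice_eq distrib_left mult.assoc)
qed


section \<open>Transfer of the computed identities\<close>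

definition horner_vars :: "lvar list" where
  "horner_vars = [Lam (Ix 5), Del (Ix 5), Lam (Ix 1), Del (Ix 1), Lam (Ix 6), Del (Ix 6), Lam (Ix 2), Del (Ix 2),
    Lam (Ix 7), Del (Ix 7), Lam (Ix 3), Del (Ix 3), Lam (Ix 8), Del (Ix 8), Lam (Ix 4), Del (Ix 4)]"

text \<open>The correctness of the Horner arithmetic makes this relation compatible with all the expressions
  above, so that each computed identity carries over to the ring.\<close>

definition represents :: "horner \<Rightarrow> 'k::comm_ring_1 Flamdel \<Rightarrow> bool" where
  "represents p f \<longleftrightarrow> horner_val horner_vars p = f"

lemma parities_horner_vars:
  "[True, True, False, False, True, True, False, False,
    True, True, False, False, True, True, False, False] = map odd_var horner_vars"
  by (simp add: horner_vars_def odd_Ix)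

lemma represents_ring:
  "represents 0 0"
  "represents p f \<Longrightarrow> represents q g \<Longrightarrow> represents (p + q) (f + g)"
  "represents p f \<Longrightarrow> represents q g \<Longrightarrow> represents (p - q) (f - g)"
  "represents p f \<Longrightarrow> represents q g \<Longrightarrow> represents (p * q) (f * g)"
  "represents p f \<Longrightarrow> represents (- p) (- f)"
  unfolding represents_def zero_horner_def plus_horner_def minus_horner_def times_horner_def
    uminus_horner_def parities_horner_vars horner_val_mult
  by (simp_all add: horner_val_add horner_val_neg)

lemma represents_vars:
  assumes "i \<in> {1..8}"
  shows "represents (horner_lam i) (lam i)" "represents (horner_del i) (dL i)"
  using assms unfolding interval_8 represents_def horner_lam_def horner_del_def lam_def dL_def
  by (auto simp: horner_val_var horner_vars_def simp del: horner_var.simps)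

lemma dual_range: "k \<in> {1..8} \<Longrightarrow> dual k \<in> {1..8}"
  by (auto simp: dual_def)

named_theorems rep

lemma represents_twice [rep]: "represents p f \<Longrightarrow> represents (twice p) (twice f)"
  by (simp add: twice_def represents_ring)

lemma represents_thrice [rep]: "represents p f \<Longrightarrow> represents (thrice p) (thrice f)"
  by (simp add: thrice_def represents_ring)

lemma represents_signed [rep]: "represents p f \<Longrightarrow> represents (signed b p) (signed b f)"
  by (simp add: signed_def represents_ring)

text \<open>The functions occurring as arguments need to correspond on the indices \<open>1, \<dots>, 8\<close> only,
  and duality preserves these.\<close>

lemma represents_pairB [rep]:
  "(\<And>i. i \<in> {1..8} \<Longrightarrow> represents (u i) (u' i)) \<Longrightarrow>
   (\<And>i. i \<in> {1..8} \<Longrightarrow> represents (v i) (v' i)) \<Longrightarrow> represents (pairB u v) (pairB u' v')"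
  by (simp add: pairB_def represents_ring)

lemma represents_pairC [rep]:
  "(\<And>i. i \<in> {1..8} \<Longrightarrow> represents (u i) (u' i)) \<Longrightarrow>
   (\<And>i. i \<in> {1..8} \<Longrightarrow> represents (v i) (v' i)) \<Longrightarrow> represents (pairC u v) (pairC u' v')"
  unfolding pairC_def by (intro represents_ring rep) (simp_all add: dual_range del: atLeastAtMost_iff One_nat_def)

lemma represents_contraction [rep]:
  "(\<And>i. i \<in> {1..8} \<Longrightarrow> represents (u i) (u' i)) \<Longrightarrow>
   (\<And>i. i \<in> {1..8} \<Longrightarrow> represents (v i) (v' i)) \<Longrightarrow> represents (contraction u v) (contraction u' v')"
  unfolding contraction_def by (intro represents_ring rep) (simp_all add: dual_range del: atLeastAtMost_iff One_nat_def)

lemma represents_cubics [rep]: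
  "(\<And>i. i \<in> {1..8} \<Longrightarrow> represents (d i) (d' i)) \<Longrightarrow> represents (cubics d i) (cubics d' i)"
  by (simp add: cubics_def represents_ring)

lemma represents_alpha_coord [rep]:
  "(\<And>i. i \<in> {1..8} \<Longrightarrow> represents (d i) (d' i)) \<Longrightarrow> i \<in> {1..8} \<Longrightarrow> k \<in> {1..8} \<Longrightarrow>
    represents (alpha_coord d i k) (alpha_coord d' i k)"
  unfolding alpha_coord_def alpha_tail_def by (intro represents_ring rep) (simp_all add: dual_range del: atLeastAtMost_iff One_nat_def)

lemma left_defect_zero:
  assumes "i \<in> {1..8}"
  shows "left_defect lam dL i = (0 :: 'k::comm_ring_1 Flamdel)"
proof -
  have "represents (left_defect horner_lam horner_del i) (left_defect lam dL i :: 'k Flamdel)"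
    unfolding left_defect_def left_factor_def using assms
    by (intro represents_ring rep represents_vars)
  moreover have "horner_zero (left_defect horner_lam horner_del i)"
    using left_checks assms by (auto simp: list_all_iff left_check_def)
  ultimately show ?thesis by (metis represents_def horner_val_zero)
qed

lemma main_identity:
  assumes "i \<in> {1..8}" "j \<in> {1..8}" "k \<in> {1..8}"
  shows "lam i * linear_part lam dL j k - cubics lam i * twice (cubic_part lam dL j k)
    + lam j * cubics lam i * twice (mixC lam dL k) = (0 :: 'k::comm_ring_1 Flamdel)"
proof -
  let ?F = "\<lambda>l d. l i * linear_part l d j k - cubics l i * twice (cubic_part l d j k)
    + l j * cubics l i * twice (mixC l d k)"
  have "represents (?F horner_lam horner_del) (?F lam dL :: 'k Flamdel)"
    unfolding linear_part_def cubic_part_def mixC_def mixB_def right_factor_def increment_def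
      alpha_tail_def using assms
    by (intro represents_ring rep represents_vars dual_range)
  moreover have "horner_zero (?F horner_lam horner_del)"
    using main_checks[OF assms(2,3)] assms(1) by (auto simp: list_all_iff main_check_def Let_def)
  ultimately show ?thesis by (metis represents_def horner_val_zero)
qed

text \<open>Substituting the value of the first sum and sorting the summands by their left factors \<open>\<lambda>\<^sub>i\<close>, \<open>\<mu>\<^sub>i\<close>
  and \<open>\<lambda>\<^sub>j \<mu>\<^sub>i\<close> turns the difference of the two sides into the computed combination.\<close>

lemma coordinate_identity:
  assumes "i \<in> {1..8}" "j \<in> {1..8}" "k \<in> {1..8}"
  shows "contraction (alpha_coord lam i) (\<lambda>m. dL m + lam m) * alpha_coord (\<lambda>m. dL m + lam m) j k
      + alpha_coord lam i k * right_factor lam dL j k =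
    (lam i * lam j * pairB lam lam - 2 * lam i * mu j - 2 * lam j * mu i) * mixC lam dL k
      + 3 * lam i * lam j * mixB lam dL k
      + left_factor lam dL i * (alpha_coord dL j k :: 'k::comm_ring_1 Flamdel)" (is "?lhs = ?rhs")
proof -
  have comm: "x * (2 * y) = 2 * (x * y)" "x * (3 * y) = 3 * (x * y)" for x y :: "'k Flamdel"
    using mult_of_nat_commute[of 2 x] mult_of_nat_commute[of 3 x] by (simp_all add: mult.assoc[symmetric])
  have K: "contraction (alpha_coord lam i) (\<lambda>m. dL m + lam m) = left_factor lam dL i"
    using left_defect_zero[OF assms(1)] by (simp add: left_defect_def)
  have "?lhs - ?rhs = lam i * linear_part lam dL j k - mu i * (2 * cubic_part lam dL j k)
    + lam j * mu i * (2 * mixC lam dL k)"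
    unfolding K unfolding left_factor_def linear_part_def cubic_part_def increment_def
      alpha_coord_def[of lam] twice_eq thrice_eq cubics_eq
    by (simp add: algebra_simps comm)
  also have "\<dots> = 0" using main_identity[OF assms] by (simp only: twice_eq cubics_eq)
  finally show ?thesis by (simp only: right_minus_eq)
qed

section \<open>The bracket of the generators\<close>

text \<open>\<open>B\<close> is odd, and \<open>\<nu>\<^sub>i\<close> and \<open>\<partial>\<close> with the dual index of \<open>i\<close> have the parity opposite to that of \<open>i\<close>, so every
  summand of \<open>\<alpha>\<^sub>i\<close> has the parity of \<open>i\<close>.\<close>

lemma homogeneous_alpha_coord:
  assumes d: "\<And>i. i \<in> {1..8} \<Longrightarrow> homogeneous (5 \<le> i) (d i)" and "i \<in> {1..8}" "k \<in> {1..8}"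
  shows "homogeneous ((5 \<le> i) \<noteq> (5 \<le> k)) (alpha_coord d i k)"
proof -
  have B: "homogeneous True (pairB d d)"
    unfolding pairB_def by (intro homogeneous_add homogeneous_mult[of False _ True])
      (use d[of 1] d[of 2] d[of 3] d[of 4] d[of 5] d[of 6] d[of 7] d[of 8] in simp_all)
  have cubic: "homogeneous (\<not> 5 \<le> i) (cubics d i)" if "i \<in> {1..8}" for i
  proof -
    have "homogeneous True (d l * d m * d n)" if "{l, m, n} \<subseteq> {5..8}" for l m n
      using that by (intro homogeneous_mult[of False _ True] homogeneous_mult[of True _ True])
        (use d[of l] d[of m] d[of n] in auto)
    with that show ?thesis unfolding interval_8 cubics_def
      by (auto intro: homogeneous_uminus homogeneous_0)
  qed
  have dual: "5 \<le> dual m \<longleftrightarrow> \<not> 5 \<le> m" if "m \<in> {1..8}" for m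
    using that by (auto simp: dual_def)
  have dk: "homogeneous (\<not> 5 \<le> k) (d (dual k))"
    using d[OF dual_range[OF assms(3)]] dual[OF assms(3)] by (simp only:)
  have ck: "homogeneous (5 \<le> k) (cubics d (dual k))"
    using cubic[OF dual_range[OF assms(3)]] dual[OF assms(3)] by (simp only: not_not)
  have "homogeneous (5 \<le> k) (alpha_tail d k)"
    unfolding alpha_tail_def by (intro homogeneous_add ck homogeneous_mult[OF B dk]) auto
  then show ?thesis
    unfolding alpha_coord_def twice_def
    by (intro homogeneous_diff homogeneous_add homogeneous_mult[OF d] homogeneous_mult[OF cubic dk] assms)
      auto
qed

lemma homogeneous_lam: "i \<in> {1..8} \<Longrightarrow> homogeneous (5 \<le> i) (lam i)"
  and homogeneous_dL: "i \<in> {1..8} \<Longrightarrow> homogeneous (5 \<le> i) (dL i)"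
  and homogeneous_dR: "i \<in> {1..8} \<Longrightarrow> homogeneous (5 \<le> i) (dR i)"
  using homogeneous_Var[of "Lam (Ix i)"] homogeneous_Var[of "Del (Ix i)"] homogeneous_Var[of "Ix i"]
  by (simp_all add: odd_Ix lam_def dL_def dR_def)

lemma alpha_coord_hom:
  fixes h :: "'a::ring_1 \<Rightarrow> 'b::ring_1"
  assumes "\<And>x y. h (x + y) = h x + h y" "\<And>x y. h (x * y) = h x * h y"
    "\<And>x y. h (x - y) = h x - h y" "\<And>x. h (- x) = - h x" "h 0 = 0"
  shows "h (alpha_coord d i k) = alpha_coord (\<lambda>m. h (d m)) i k"
  by (simp add: alpha_coord_def alpha_tail_def pairB_def cubics_def twice_def assms)

text \<open>The coordinates of \<open>\<alpha>\<^sub>i\<close> have even degree \<open>4\<close>, so the sign in the substitution \<open>\<partial> \<mapsto> - \<lambda>\<close> disappears.\<close>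

lemma neg_lam_alpha_coord:
  "neg_lam (alpha_coord dR i k) = (alpha_coord lam i k :: 'k::comm_ring_1 Flamdel)"
proof -
  have "neg_lam (alpha_coord dR i k) = (alpha_coord (\<lambda>m. - lam m) i k :: 'k Flamdel)"
    by (subst alpha_coord_hom[where h = neg_lam])
      (simp_all add: neg_lam_simps dR_def lam_def, simp_all add: neg_lam_def subst_diff subst_uminus)
  also have "\<dots> = alpha_coord lam i k"
  proof -
    have "cubics (\<lambda>m. - lam m) n = - (cubics lam n :: 'k Flamdel)" for n
      by (simp add: cubics_def)
    moreover have "pairB (\<lambda>m. - lam m) (\<lambda>m. - lam m) = (pairB lam lam :: 'k Flamdel)"
      by (simp add: pairB_def)
    ultimately show ?thesis by (simp add: alpha_coord_def alpha_tail_def algebra_simps)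
  qed
  finally show ?thesis .
qed

lemma shift_lam_alpha_coord:
  "shift_lam (alpha_coord dR i k) = alpha_coord (\<lambda>m. dL m + lam m) i k"
  by (subst alpha_coord_hom[where h = shift_lam])
    (simp_all add: shift_lam_simps dR_def lam_def dL_def, simp_all add: shift_lam_def subst_diff subst_uminus)

lemma supercommuting_Del: "supercommuting (\<lambda>i. Var (Del i) :: 'k::comm_ring_1 Flamdel)"
  by (rule supercommuting_Var) simp

lemma alphaL_nth: "k \<in> {1..8} \<Longrightarrow> alphaL i $ Ix k = alpha_coord dL i k"
  unfolding one_tensor_def vec_lambda_beta del_poly_def
  by (simp only: alpha_nth) (subst alpha_coord_hom[where h = "subst (\<lambda>i. Var (Del i))"],
    simp_all add: subst_add subst_mult[OF supercommuting_Del] subst_diff subst_uminus dR_def dL_def[abs_def]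
      subst_Var[OF supercommuting_Del])

lemma RW_bracket_alpha_nth:
  assumes "j \<in> {1..8}" "k \<in> {1..8}"
  shows "RW_bracket (alpha i) (alpha j :: 'k::comm_ring_1 RW) $ Ix k =
    contraction (alpha_coord lam i) (\<lambda>m. dL m + lam m) * alpha_coord (\<lambda>m. dL m + lam m) j k
      + alpha_coord lam i k * right_factor lam dL j k"
proof -
  let ?D = "\<lambda>m. dL m + lam m :: 'k Flamdel"
  let ?Y = "contraction (alpha_coord ?D j) lam"
  have D: "homogeneous (5 \<le> i) (?D i)" if "i \<in> {1..8}" for i
    using that by (intro homogeneous_add homogeneous_dL homogeneous_lam)
  have "homogeneous (5 \<le> j) (alpha_coord ?D j m * lam m)" if "m \<in> {1..8}" for m
    using that assms
    by (intro homogeneous_mult[OF homogeneous_alpha_coord[OF D] homogeneous_lam]) auto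
  then have "homogeneous (5 \<le> j) ?Y"
    unfolding contraction_eq_sum by (rule homogeneous_sum)
  then have Y: "twist (5 \<le> k) ?Y = right_factor lam dL j k"
    by (simp add: twist_homogeneous right_factor_def signed_def conj_commute)
  have X: "(\<Sum>m=1..8. neg_lam ((alpha i :: 'k RW) $ Ix m) * (Var (Del (Ix m)) + Var (Lam (Ix m)))) =
      contraction (alpha_coord lam i) ?D"
    unfolding contraction_eq_sum dL_def[symmetric] lam_def[symmetric]
    by (intro sum.cong refl) (simp add: alpha_nth neg_lam_alpha_coord)
  have Y': "(\<Sum>m=1..8. shift_lam ((alpha j :: 'k RW) $ Ix m) * Var (Lam (Ix m))) = ?Y"
    unfolding contraction_eq_sum lam_def[symmetric]
    by (intro sum.cong refl) (simp add: alpha_nth shift_lam_alpha_coord)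
  show ?thesis
    unfolding RW_bracket_coord sum_ix X Y' odd_Ix[OF assms(2)] Y
    by (simp add: alpha_nth[OF assms(2)] neg_lam_alpha_coord shift_lam_alpha_coord)
qed

lemma RW_bracket_alpha:
  assumes "i \<in> {1..8}" "j \<in> {1..8}"
  shows "RW_bracket (alpha i) (alpha j :: 'k::comm_ring_1 RW) =
    (lam i * lam j * Bform (*) lam lam - 2 * lam i * mu j - 2 * lam j * mu i) *s Cform (*s) lam alphaL
    + (3 * lam i * lam j) *s Bform (*s) mu alphaL
    + (lam i * Cform (*) mu dL + lam i * Bform (*) lam lam * Cform (*) lam dL
        - 2 * mu i * Cform (*) lam dL) *s alphaL j" (is "_ = ?rhs")
  unfolding vec_eq_iff
proof
  fix n :: ix
  obtain k where n: "n = Ix k" and k: "k \<in> {1..8}" using idx idx_inverse by metis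
  have C: "(Cform (*s) lam alphaL :: 'k FlamRW) $ Ix k = mixC lam dL k"
    and B: "(Bform (*s) mu alphaL :: 'k FlamRW) $ Ix k = mixB lam dL k"
    by (simp_all only: Cform_smult_coord Bform_smult_coord alphaL_nth[OF k] mixC_def mixB_def pairC_eq pairB_eq cubics_eq)
  show "RW_bracket (alpha i) (alpha j) $ n = ?rhs $ n"
    unfolding n RW_bracket_alpha_nth[OF assms(2) k] coordinate_identity[OF assms k]
    by (simp add: C B alphaL_nth[OF k] left_factor_def pairB_eq pairC_eq cubics_eq twice_eq mult.assoc)
qed


section \<open>Tensoring a submodule with the polynomials in \<open>\<lambda>\<close>\<close>

lemma submodule_add: "RW_submodule S \<Longrightarrow> x \<in> S \<Longrightarrow> y \<in> S \<Longrightarrow> x + y \<in> S"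
  and submodule_smult: "RW_submodule S \<Longrightarrow> x \<in> S \<Longrightarrow> f *s x \<in> S"
  and submodule_rmult: "RW_submodule S \<Longrightarrow> x \<in> S \<Longrightarrow> x *r f \<in> S"
  and submodule_vpart: "RW_submodule S \<Longrightarrow> x \<in> S \<Longrightarrow> vpart b x \<in> S"
  by (simp_all add: RW_submodule_def)

lemma lam_tensor_zero: "0 \<in> lam_tensor S"
  unfolding lam_tensor_def by (rule CollectI, rule exI[of _ 0]) simp

lemma lam_tensor_add:
  fixes S :: "'k::comm_ring_1 RW set"
  assumes "x \<in> lam_tensor S" "y \<in> lam_tensor S"
  shows "x + y \<in> lam_tensor S"
proof -
  obtain m :: nat and f s where x: "x = (\<Sum>k<m. lam_poly (f k) *s one_tensor (s k))" "\<forall>k<m. s k \<in> S"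
    using assms(1) unfolding lam_tensor_def mem_Collect_eq by blast
  obtain n :: nat and g t where y: "y = (\<Sum>k<n. lam_poly (g k) *s one_tensor (t k))" "\<forall>k<n. t k \<in> S"
    using assms(2) unfolding lam_tensor_def mem_Collect_eq by blast
  let ?f = "\<lambda>k. if k < m then f k else g (k - m)" and ?s = "\<lambda>k. if k < m then s k else t (k - m)"
  have "(\<Sum>k<m + n. h k) = (\<Sum>k<m. h k) + (\<Sum>k<n. h (m + k))" for h :: "nat \<Rightarrow> 'k FlamRW"
    by (induction n) (simp_all add: add_ac)
  then have "(\<Sum>k<m + n. lam_poly (?f k) *s one_tensor (?s k)) = x + y"
    unfolding x(1) y(1) by simp
  moreover have "\<forall>k<m + n. ?s k \<in> S" using x(2) y(2) by auto
  ultimately show ?thesis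
    unfolding lam_tensor_def
    by - (rule CollectI, rule exI[of _ "m + n"], rule exI[of _ ?f], rule exI[of _ ?s],
      rule conjI, erule sym, assumption)
qed

lemma lam_tensor_sum: "(\<And>a. a \<in> A \<Longrightarrow> F a \<in> lam_tensor S) \<Longrightarrow> sum F A \<in> lam_tensor S"
  by (induction A rule: infinite_finite_induct) (auto intro: lam_tensor_zero lam_tensor_add)

lemma lam_tensor_gen: "s \<in> S \<Longrightarrow> lam_poly f *s one_tensor s \<in> lam_tensor S"
  unfolding lam_tensor_def
  by (rule CollectI, rule exI[of _ 1], rule exI[of _ "\<lambda>_. f"], rule exI[of _ "\<lambda>_. s"]) simp

lemma supercommuting_Lam: "supercommuting (\<lambda>i. Var (Lam i) :: 'k::comm_ring_1 Flamdel)"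
  by (rule supercommuting_Var) simp

lemma lam_tensor_one: "s \<in> S \<Longrightarrow> one_tensor s \<in> lam_tensor S" for S :: "'k::comm_ring_1 RW set"
  using lam_tensor_gen[of s S 1] subst_const[OF supercommuting_Lam, of "1 :: 'k"]
  by (simp add: lam_poly_def smult_simps)

lemma lam_tensor_image:
  fixes S :: "'k::comm_ring_1 RW set"
  assumes add: "\<And>x y. T (x + y) = T x + T y"
    and gen: "\<And>f s. s \<in> S \<Longrightarrow> T (lam_poly f *s one_tensor s) \<in> lam_tensor S"
    and "x \<in> lam_tensor S"
  shows "T x \<in> lam_tensor S"
proof -
  obtain m :: nat and f s where x: "x = (\<Sum>k<m. lam_poly (f k) *s one_tensor (s k))" "\<forall>k<m. s k \<in> S"
    using assms(3) unfolding lam_tensor_def mem_Collect_eq by blast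
  have "T 0 = 0" using add[of 0 0] by simp
  then have "T x = (\<Sum>k<m. T (lam_poly (f k) *s one_tensor (s k)))"
    unfolding x(1) by (induction m) (simp_all add: add)
  then show ?thesis using x(2) by (auto intro: lam_tensor_sum gen)
qed

lemma twist_del_poly: "twist b (del_poly f) = del_poly (twist b f)"
  unfolding del_poly_def by (rule twist_subst[OF supercommuting_Del]) (simp add: twist_Var)

lemma twist_lam_poly: "twist b (lam_poly f) = lam_poly (twist b f)"
  unfolding lam_poly_def by (rule twist_subst[OF supercommuting_Lam]) (simp add: twist_Var)

lemma one_tensor_smult: "one_tensor (f *s x) = del_poly f *s one_tensor x"
  by (simp add: one_tensor_def vec_eq_iff del_poly_def subst_mult[OF supercommuting_Del])

lemma one_tensor_rmult: "one_tensor (x *r f) = one_tensor x *r del_poly f"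
  by (simp add: one_tensor_def rmult_def vec_eq_iff twist_del_poly)
    (simp add: del_poly_def subst_mult[OF supercommuting_Del])

lemma lam_tensor_smult_const:
  assumes "RW_submodule S" "x \<in> lam_tensor S"
  shows "const c *s x \<in> lam_tensor S"
proof (rule lam_tensor_image[OF smult_simps(2) _ assms(2)])
  fix f :: "'a Fdel" and s assume s: "s \<in> S"
  have "const c *s (lam_poly f *s one_tensor s) = lam_poly (const c * f) *s one_tensor s"
    by (simp add: lam_poly_def subst_mult[OF supercommuting_Lam] subst_const[OF supercommuting_Lam] smult_simps)
  then show "const c *s (lam_poly f *s one_tensor s) \<in> lam_tensor S"
    by (simp add: lam_tensor_gen s)
qed

text \<open>A variable \<open>\<lambda>\<^sub>i\<close> is absorbed by the polynomial factor, and \<open>\<partial>\<^sub>i\<close>, moved past that factor, by the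
  factor in \<open>S\<close>.\<close>

lemma lam_tensor_smult_Var:
  assumes "RW_submodule S" "x \<in> lam_tensor S"
  shows "Var v *s x \<in> lam_tensor S"
proof (rule lam_tensor_image[OF smult_simps(2) _ assms(2)])
  fix f :: "'a Fdel" and s assume s: "s \<in> S"
  show "Var v *s (lam_poly f *s one_tensor s) \<in> lam_tensor S"
  proof (cases v)
    case (Lam i)
    have "Var v *s (lam_poly f *s one_tensor s) = lam_poly (Var i * f) *s one_tensor s"
      by (simp add: Lam lam_poly_def subst_mult[OF supercommuting_Lam] subst_Var[OF supercommuting_Lam] smult_simps)
    then show ?thesis by (simp add: lam_tensor_gen s)
  next
    case (Del i)
    have "Var v * lam_poly f = twist (odd_var i) (lam_poly f) * Var v"
      by (simp add: mult_Var Del)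
    then have "Var v *s (lam_poly f *s one_tensor s) =
        lam_poly (twist (odd_var i) f) *s one_tensor (Var i *s s)"
      unfolding one_tensor_smult smult_simps(3)[symmetric] twist_lam_poly
      by (simp add: Del del_poly_def subst_Var[OF supercommuting_Del])
    then show ?thesis by (simp add: lam_tensor_gen s submodule_smult assms(1))
  qed
qed

lemma lam_tensor_smult:
  assumes "RW_submodule S" "x \<in> lam_tensor S"
  shows "f *s x \<in> lam_tensor S"
proof (induction f rule: spoly_induct)
  case (Var v f)
  then show ?case by (simp add: smult_simps lam_tensor_smult_Var assms)
qed (simp_all add: smult_simps lam_tensor_smult_const lam_tensor_add assms)

text \<open>Moving \<open>\<lambda>\<^sub>i\<close> to the left past \<open>s\<close> changes the sign of the odd part of \<open>s\<close> if \<open>i\<close> is odd. The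
  result stays in \<open>F[\<lambda>] \<otimes> S\<close> because \<open>S\<close> is graded.\<close>

lemma lam_tensor_rmult_Var:
  assumes "RW_submodule S" "x \<in> lam_tensor S"
  shows "x *r Var v \<in> lam_tensor S"
proof (rule lam_tensor_image[OF rmult_simps(1) _ assms(2)])
  fix f :: "'a Fdel" and s assume s: "s \<in> S"
  have "one_tensor s *r Var v \<in> lam_tensor S"
  proof (cases v)
    case (Lam i)
    have minus: "del_poly (- f) = - del_poly f" for f :: "'a Fdel"
      by (simp add: del_poly_def subst_uminus)
    define s' where "s' = (if odd_var i then vpart False s + (-1) *s vpart True s else s)"
    have "twist True (s $ n) = (if odd_var n then - (s' $ n) else s' $ n)" if "odd_var i" for n
      using that by (simp add: s'_def vpart_def twist_def)
    then have "del_poly (s $ n) * twist (odd_var n) (Var v) = Var v * del_poly (s' $ n)" for n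
      by (cases "odd_var i") (simp_all add: Lam twist_Var mult_Var twist_del_poly minus, simp add: s'_def)
    then have "one_tensor s *r Var v = Var v *s one_tensor s'"
      by (simp add: vec_eq_iff rmult_def one_tensor_def)
    moreover have "s' \<in> S"
      using s assms(1) by (auto simp: s'_def intro: submodule_add submodule_smult submodule_vpart)
    ultimately show ?thesis
      by (simp add: lam_tensor_smult_Var lam_tensor_one assms(1))
  next
    case (Del i)
    have "one_tensor s *r Var v = one_tensor (s *r Var i)"
      by (simp add: one_tensor_rmult Del del_poly_def subst_Var[OF supercommuting_Del])
    then show ?thesis by (simp add: lam_tensor_one submodule_rmult s assms(1))
  qed
  then show "(lam_poly f *s one_tensor s) *r Var v \<in> lam_tensor S"
    by (simp add: rmult_simps lam_tensor_smult assms(1))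
qed

lemma lam_tensor_rmult:
  assumes "RW_submodule S" "x \<in> lam_tensor S"
  shows "x *r f \<in> lam_tensor S"
  using assms(2)
proof (induction f arbitrary: x rule: spoly_induct)
  case (Var v f)
  then show ?case by (simp add: rmult_simps lam_tensor_rmult_Var assms(1))
qed (simp_all add: rmult_const rmult_simps lam_tensor_smult lam_tensor_add assms(1))

section \<open>The submodule generated by the elements\<close>

lemma vpart_smult: "vpart c x = x \<Longrightarrow> vpart b (f *s x) = hpart (b \<noteq> c) f *s x"
proof -
  assume x: "vpart c x = x"
  have "hpart (b \<noteq> odd_var n) (f * x $ n) = hpart (b \<noteq> c) f * x $ n" for n
  proof -
    have "hpart (c \<noteq> odd_var n) (x $ n) = x $ n"
      using arg_cong[OF x, of "\<lambda>y. y $ n"] by (simp add: vpart_def)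
    from hpart_mult[OF this] have
      "hpart (b \<noteq> odd_var n) (f * x $ n) = hpart ((b \<noteq> odd_var n) \<noteq> (c \<noteq> odd_var n)) f * x $ n" .
    moreover have "((b \<noteq> odd_var n) \<noteq> (c \<noteq> odd_var n)) = (b \<noteq> c)" by auto
    ultimately show ?thesis by (simp only:)
  qed
  then show ?thesis by (simp add: vpart_def vec_eq_iff)
qed

lemma vpart_alpha:
  assumes "i \<in> {1..8}"
  shows "vpart (5 \<le> i) (alpha i) = alpha i"
  unfolding vec_eq_iff
proof
  fix n :: ix
  obtain k where n: "n = Ix k" and k: "k \<in> {1..8}" using idx idx_inverse by metis
  show "vpart (5 \<le> i) (alpha i) $ n = alpha i $ n"
    using homogeneous_alpha_coord[OF homogeneous_dR assms k]
    by (simp add: n vpart_def alpha_nth[OF k] odd_Ix[OF k] homogeneous_def del: not_iff)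
qed

lemma RW_submodule_RE: "RW_submodule RE"
  unfolding RE_def RW_submodule_def by blast

lemma alpha_in_RE: "i \<in> {1..8} \<Longrightarrow> alpha i \<in> RE"
  unfolding RE_def by blast

text \<open>Because the \<open>\<alpha>\<^sub>i\<close> are homogeneous, their left linear span is closed under the right action and
  under taking even and odd parts.\<close>

lemma RE_span:
  assumes "x \<in> RE"
  obtains f where "x = (\<Sum>i=1..8. f i *s alpha i)"
proof -
  let ?N = "range (\<lambda>f. \<Sum>i=1..8. f i *s alpha i) :: 'a RW set"
  have "RW_submodule ?N"
    unfolding RW_submodule_def
  proof (intro conjI ballI allI)
    show "0 \<in> ?N" by (rule range_eqI[of _ _ "\<lambda>_. 0"]) (simp add: smult_simps)
  next
    fix x y assume "x \<in> ?N" "y \<in> ?N"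
    then obtain f g where "x = (\<Sum>i=1..8. f i *s alpha i)" "y = (\<Sum>i=1..8. g i *s alpha i)" by blast
    then have "x + y = (\<Sum>i=1..8. (f i + g i) *s alpha i)" by (simp add: smult_simps sum.distrib)
    then show "x + y \<in> ?N" by - (rule range_eqI)
  next
    fix g x assume "x \<in> ?N"
    then obtain f where x: "x = (\<Sum>i=1..8. f i *s alpha i)" by blast
    have "g *s x = (\<Sum>i=1..8. (g * f i) *s alpha i)" unfolding x smult_sum smult_simps(3) ..
    then show "g *s x \<in> ?N" by - (rule range_eqI)
    have "x *r g = (\<Sum>i=1..8. (f i * twist (5 \<le> i) g) *s alpha i)"
      unfolding x rmult_sum rmult_simps(7) smult_simps(3)
      by (intro sum.cong refl) (simp add: rmult_homogeneous[OF vpart_alpha])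
    then show "x *r g \<in> ?N" by - (rule range_eqI)
  next
    fix b x assume "x \<in> ?N"
    then obtain f where x: "x = (\<Sum>i=1..8. f i *s alpha i)" by blast
    have "vpart b (sum F A) = (\<Sum>a\<in>A. vpart b (F a))" for F :: "nat \<Rightarrow> 'a RW" and A
      by (simp add: vpart_def vec_eq_iff hpart_sum)
    then have "vpart b x = (\<Sum>i=1..8. vpart b (f i *s alpha i))" by (simp only: x)
    also have "\<dots> = (\<Sum>i=1..8. hpart (b \<noteq> (5 \<le> i)) (f i) *s alpha i)"
      by (intro sum.cong refl vpart_smult vpart_alpha)
    finally show "vpart b x \<in> ?N" by - (rule range_eqI)
  qed
  moreover have "alpha i \<in> ?N" if "i \<in> {1..8}" for i
  proof -
    have "alpha i = (\<Sum>m=1..8. (if m = i then 1 else 0) *s alpha m)"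
      using that by (simp add: if_distrib[of "\<lambda>c. c *s _"] smult_simps cong: if_cong)
    then show ?thesis by - (rule range_eqI)
  qed
  ultimately have "RE \<subseteq> ?N" unfolding RE_def by blast
  with assms that show ?thesis by blast
qed

lemma RW_bracket_sum:
  "RW_bracket (sum F A) y = (\<Sum>a\<in>A. RW_bracket (F a) y)"
  "RW_bracket x (sum F A) = (\<Sum>a\<in>A. RW_bracket x (F a))"
proof -
  have "RW_bracket 0 y = 0" "RW_bracket x 0 = 0"
    using RW_bracket_add_left[of 0 0 y] RW_bracket_add_right[of x 0 0] by simp_all
  then show "RW_bracket (sum F A) y = (\<Sum>a\<in>A. RW_bracket (F a) y)"
    "RW_bracket x (sum F A) = (\<Sum>a\<in>A. RW_bracket x (F a))"
    by (induction A rule: infinite_finite_induct) (simp_all add: RW_bracket_add_left RW_bracket_add_right)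
qed

lemma RW_bracket_alpha_in:
  assumes "i \<in> {1..8}" "j \<in> {1..8}"
  shows "RW_bracket (alpha i) (alpha j) \<in> lam_tensor (RE :: 'k::comm_ring_1 RW set)"
proof -
  have alpha: "(alphaL m :: 'k FlamRW) \<in> lam_tensor RE" if "m \<in> {1..8}" for m
    using that by (intro lam_tensor_one alpha_in_RE)
  have "Bform (*s) u alphaL \<in> lam_tensor (RE :: 'k RW set)"
    and "Cform (*s) u alphaL \<in> lam_tensor (RE :: 'k RW set)" for u
    by (simp_all add: Cform_expand Bform_expand dual_def lam_tensor_add lam_tensor_smult RW_submodule_RE alpha)
  then show ?thesis
    unfolding RW_bracket_alpha[OF assms] using alpha[OF assms(2)]
    by (intro lam_tensor_add lam_tensor_smult RW_submodule_RE)
qed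

text \<open>By homogeneity the second argument can be written with coefficients on the right, and
  sesquilinearity reduces the claim to the brackets of the generators \<open>\<alpha>\<^sub>i\<close>.\<close>

lemma conformal_subalgebra_RE: "conformal_subalgebra (RE :: 'k::comm_ring_1 RW set)"
  unfolding conformal_subalgebra_def
proof (intro conjI ballI RW_submodule_RE)
  fix x y :: "'k RW" assume "x \<in> RE" "y \<in> RE"
  obtain f where x: "x = (\<Sum>i=1..8. f i *s alpha i)" using RE_span[OF \<open>x \<in> RE\<close>] .
  obtain g where y: "y = (\<Sum>j=1..8. g j *s alpha j)" using RE_span[OF \<open>y \<in> RE\<close>] .
  have terms: "RW_bracket (f i *s alpha i) (g j *s alpha j) \<in> lam_tensor RE" if "i \<in> {1..8}" "j \<in> {1..8}" for i j
  proof -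
    have "g j *s alpha j = alpha j *r twist (5 \<le> j) (g j)"
      unfolding rmult_homogeneous[OF vpart_alpha[OF that(2)]] by simp
    then have "RW_bracket (f i *s alpha i) (g j *s alpha j) = neg_lam (f i) *s
        (RW_bracket (alpha i) (alpha j) *r shift_lam (twist (5 \<le> j) (g j)))"
      by (simp only: RW_bracket_left RW_bracket_right rmult_simps(7))
    then show ?thesis
      by (simp only: lam_tensor_smult lam_tensor_rmult RW_submodule_RE RW_bracket_alpha_in that)
  qed
  show "RW_bracket x y \<in> lam_tensor RE"
    unfolding x y RW_bracket_sum by (rule lam_tensor_sum, rule lam_tensor_sum, rule terms)
qed

theorem theorem3p6:
  shows "(\<forall>i\<in>{1..8}. \<forall>j\<in>{1..8}.
      RW_bracket (alpha i) (alpha j :: 'k::field_char_0 RW) =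
        (lam i * lam j * Bform (*) lam lam - 2 * lam i * mu j - 2 * lam j * mu i) *s Cform (*s) lam alphaL
        + (3 * lam i * lam j) *s Bform (*s) mu alphaL
        + (lam i * Cform (*) mu dL + lam i * Bform (*) lam lam * Cform (*) lam dL
            - 2 * mu i * Cform (*) lam dL) *s alphaL j) \<and>
    conformal_subalgebra (RE :: 'k RW set)"
  using RW_bracket_alpha conformal_subalgebra_RE by blast

end
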